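(* Let $N\ge2$, let $T_1=T_{f_1,w_1},\dots,T_N=T_{f_N,w_N}$ be unilateral pseudo-shifts on $c_0(\mathbb{N})$, and let $\mathcal{A}$ be one of the families $\mathcal{A}_\infty$, $\mathcal{A}_{uBd}$, $\mathcal{A}_{ud}$, $\mathcal{A}_{ld}$. If $\mathcal{A}$ is $(f_s)_{s=1}^N$-weakly partition regular, then $T_1,\dots,T_N$ are disjoint $\mathcal{A}$-hypercyclic if and only if there exist sets $A_k\in\mathcal{A}$, $k\ge1$, and a sequence $(\varepsilon_k)_{k\ge1}$ of positive real numbers tending to $0$ such that: (1) for any $1\le j\le k$ and any $s\in[N]$, $\lim_{n\in A_k}|W^s_{j,n}|=\infty$ (the limit as $n\to\infty$ along $A_k$), and for any $l,k\ge1$, any $n\in A_l$, $m\in A_k$, any $s\in[N]$ and any $j\in f_s^m([k])\cap f_s^n((l,+\infty))$, $$\frac{|W^s_{f_s^{-n}(j),n}|}{|W^s_{f_s^{-m}(j),m}|}\le\min\{\varepsilon_l,\varepsilon_k\};$$ (2) for any $1\le j\le l$, any $k\ge1$, any $n\in A_k$, any $s\ne t\in[N]$, any $m\in A_l\setminus\{n\}$, if $f_t^m(j)\in f_s^n((k,+\infty))$ then $$\frac{|W^s_{f_s^{-n}(f_t^m(j)),n}|}{|W^t_{j,m}|}\le\varepsilon_l;$$ (3) for any $1\le j\le k<l$, any $n\in A_l$, any $s\ne t\in[N]$, any $m\in A_k$, if $f_t^m(j)\in f_s^n((l,+\infty))$ then $$\frac{|W^s_{f_s^{-n}(f_t^m(j)),n}|}{|W^t_{j,m}|}\le\varepsilon_l;$$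 (4) for any $l\ge1$, any scalars $(a_{s,j})_{s\in[N],j\in[l]}$ with all $a_{s,j}\ne0$, and any $\varepsilon>0$, there exists $L\ge l$ such that for every $s\ne t\in[N]$ and any $n\in A_L$: (a) for every $j\in f_t^n([l])\cap f_s^n([l])$, $\left|\frac{W^s_{f_s^{-n}(j),n}}{W^t_{f_t^{-n}(j),n}}-\frac{a_{s,f_s^{-n}(j)}}{a_{t,f_t^{-n}(j)}}\right|\le\varepsilon$; (b) for every $j\in f_t^n([l])\cap f_s^n((l,\infty))$, $\frac{|W^s_{f_s^{-n}(j),n}|}{|W^t_{f_t^{-n}(j),n}|}\le\varepsilon$. Here $W^s_{l,n}=\prod_{\nu=1}^nw_{s,f_s^\nu(l)}$ for all $s\in[N]$.
   Context: $\mathbb{N}=\{1,2,\dots\}$, $[l]=\{1,\dots,l\}$, $(l,\infty)$ denotes the integers $>l$; spaces are over $\mathbb{K}=\mathbb{R}$ or $\mathbb{C}$ with canonical basis $(e_j)_{j\ge1}$. $f^n$ is the $n$-th iterate of $f$ and, for injective $f$, $f^{-n}$ is the inverse of $f^n$ on its range. Pseudo-shift: for a bounded weight sequence of scalars $w=(w_j)_{j\in\mathbb{N}}$ and a strictly increasing $f:\mathbb{N}\to\mathbb{N}$ with $f(1)>1$, $T_{f,w}\big(\sum_{j\ge1}x_je_j\big)=\sum_{j\ge1}w_{f(j)}x_{f(j)}e_j$. We write $w_s=(w_{s,j})_{j\in\mathbb{N}}$. For $A\subset\mathbb{N}$: $\underline{\mathrm{dens}}\,A=\liminf_{M\to\infty}\frac{\mathrm{card}\{n\le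 M:n\in A\}}{M}$, $\overline{\mathrm{dens}}\,A=\limsup_{M\to\infty}\frac{\mathrm{card}\{n\le M:n\in A\}}{M}$, $\overline{\mathrm{Bd}}\,A=\limsup_{M\to\infty}\max_{k\ge1}\frac{\mathrm{card}(A\cap\{k+1,\dots,k+M\})}{M}$. The families $\mathcal{A}_\infty,\mathcal{A}_{uBd},\mathcal{A}_{ud},\mathcal{A}_{ld}$ consist of the subsets of $\mathbb{N}$ that are, respectively, infinite, of positive upper Banach density, of positive upper density, of positive lower density. $T_1,\dots,T_N$ are disjoint $\mathcal{A}$-hypercyclic if there is $x\in X$ (here $X=c_0(\mathbb{N})$) such that for all non-empty open $V_1,\dots,V_N\subset X$, $\{n:T_s^nx\in V_s\text{ for all }s\in[N]\}\in\mathcal{A}$. $\mathcal{A}$ is $(f_s)_{s=1}^N$-weakly partition regular if for any sequence $(B_l)_{l\ge1}\subset\mathcal{A}$ there is a sequence $(A_l)_{l\ge1}\subset\mathcal{A}$ such that $A_l\subseteq B_l$ for every $l\ge1$, and for every $l,k\ge1$, $f_s^m([l])\cap f_t^n([k])=\emptyset$ for all $m\in A_l$, $n\in A_k$ with $m\ne n$ and all $s,t\in[N]$. *)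

theory Defs
  imports "HOL-Analysis.Analysis"
begin

text \<open>
  The positive integers are \<open>{1..} :: nat set\<close>. Sequences indexed by them are functions on
  \<open>nat\<close>; in \<open>c0\<close> the unused coordinate \<open>0\<close> is forced to vanish, so that the supremum norm of
  \<open>nat \<Rightarrow>\<^sub>C 'k\<close> is the norm of \<open>c\<^sub>0(\<nat>)\<close>. Every other value at \<open>0\<close> is irrelevant.

  The scalar field has sort \<open>{real_normed_field, euclidean_space}\<close>. Its models are exactly the
  real and the complex numbers (Frobenius: a finite-dimensional commutative real division
  algebra, with a multiplicative norm).
\<close>

definition c0 :: "(nat \<Rightarrow>\<^sub>C 'k::{real_normed_field,euclidean_space}) set" where
  "c0 = {x. apply_bcontfun x 0 = 0 \<and> apply_bcontfun x \<longlonglongrightarrow> 0}"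

definition is_pseudo_shift ::
    "(nat \<Rightarrow> nat) \<Rightarrow> (nat \<Rightarrow> 'k::{real_normed_field,euclidean_space}) \<Rightarrow> bool" where
  "is_pseudo_shift f w \<longleftrightarrow> bounded (w ` {1..}) \<and> strict_mono_on {1..} f \<and> f 1 > 1"

definition pseudo_shift ::
    "(nat \<Rightarrow> nat) \<Rightarrow> (nat \<Rightarrow> 'k::{real_normed_field,euclidean_space}) \<Rightarrow> (nat \<Rightarrow>\<^sub>C 'k) \<Rightarrow> (nat \<Rightarrow>\<^sub>C 'k)"
where
  "pseudo_shift f w x =
     Bcontfun (\<lambda>j. if j = 0 then 0 else w (f j) * apply_bcontfun x (f j))"

lemma is_pseudo_shift_ge:
  assumes "is_pseudo_shift f w" "j \<ge> 1"
  shows "f j > j"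
  using assms(2)
proof (induction j rule: dec_induct)
  case base
  then show ?case using assms(1) by (simp add: is_pseudo_shift_def)
next
  case (step n)
  have "f n < f (Suc n)"
    using assms(1) step.hyps by (auto simp: is_pseudo_shift_def strict_mono_on_def)
  with step.IH show ?case by linarith
qed

lemma pseudo_shift_apply:
  assumes "is_pseudo_shift f w"
  shows "apply_bcontfun (pseudo_shift f w x) j =
           (if j = 0 then 0 else w (f j) * apply_bcontfun x (f j))"
proof -
  obtain B where B: "\<And>i. i \<ge> 1 \<Longrightarrow> norm (w i) \<le> B"
    using assms by (auto simp: is_pseudo_shift_def bounded_iff)
  have B0: "0 \<le> B"
    using B[of 1] norm_ge_zero[of "w 1"] by linarith
  have "norm (if j = 0 then 0 else w (f j) * apply_bcontfun x (f j)) \<le> B * norm x" for j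
  proof (cases "j = 0")
    case False
    have "f j \<ge> 1"
      using is_pseudo_shift_ge[OF assms, of j] False by simp
    with False show ?thesis
      by (auto simp: norm_mult intro!: mult_mono B B0 norm_bounded)
  qed (use B0 in simp)
  then have "(\<lambda>j. if j = 0 then 0 else w (f j) * apply_bcontfun x (f j)) \<in> bcontfun"
    by (intro bcontfun_normI[where b = "B * norm x"]) auto
  then show ?thesis
    by (simp add: pseudo_shift_def Bcontfun_inverse)
qed

lemma pseudo_shift_in_c0:
  assumes "is_pseudo_shift f w" "x \<in> c0"
  shows "pseudo_shift f w x \<in> c0"
proof -
  obtain B where B: "\<And>i. i \<ge> 1 \<Longrightarrow> norm (w i) \<le> B"
    using assms(1) by (auto simp: is_pseudo_shift_def bounded_iff)
  have ge: "f j \<ge> j" "f j \<ge> 1" if "j \<ge> 1" for j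
    using is_pseudo_shift_ge[OF assms(1) that] that by auto
  have "filterlim f at_top sequentially"
    by (rule filterlim_at_top_mono[OF filterlim_ident eventually_sequentiallyI[of 1]])
       (use ge in auto)
  then have lim: "(\<lambda>j. apply_bcontfun x (f j)) \<longlonglongrightarrow> 0"
    using assms(2) filterlim_compose[of "apply_bcontfun x"] by (auto simp: c0_def)
  have "(\<lambda>j. B * norm (apply_bcontfun x (f j))) \<longlonglongrightarrow> 0"
    using tendsto_mult_right_zero[OF tendsto_norm_zero[OF lim]] .
  then have "apply_bcontfun (pseudo_shift f w x) \<longlonglongrightarrow> 0"
    by (rule Lim_null_comparison[rotated], intro eventually_sequentiallyI[of 1])
       (use ge in \<open>auto simp: pseudo_shift_apply[OF assms(1)] norm_mult intro!: mult_right_mono B\<close>)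
  then show ?thesis
    by (simp add: c0_def pseudo_shift_apply[OF assms(1)])
qed

definition lower_dens :: "nat set \<Rightarrow> ereal" where
  "lower_dens A = liminf (\<lambda>M. ereal (real (card {n \<in> {1..M}. n \<in> A}) / real M))"

definition upper_dens :: "nat set \<Rightarrow> ereal" where
  "upper_dens A = limsup (\<lambda>M. ereal (real (card {n \<in> {1..M}. n \<in> A}) / real M))"

text \<open>The maximum below is over a non-empty subset of \<open>{..M}\<close>, so \<open>Max\<close> is meaningful.\<close>

definition upper_Banach_dens :: "nat set \<Rightarrow> ereal" where
  "upper_Banach_dens A =
     limsup (\<lambda>M. ereal (real (Max ((\<lambda>k. card (A \<inter> {k+1..k+M})) ` {1..})) / real M))"

definition A_inf :: "nat set set" where
  "A_inf = {A. A \<subseteq> {1..} \<and> infinite A}"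

definition A_uBd :: "nat set set" where
  "A_uBd = {A. A \<subseteq> {1..} \<and> upper_Banach_dens A > 0}"

definition A_ud :: "nat set set" where
  "A_ud = {A. A \<subseteq> {1..} \<and> upper_dens A > 0}"

definition A_ld :: "nat set set" where
  "A_ld = {A. A \<subseteq> {1..} \<and> lower_dens A > 0}"

text \<open>The operators \<open>T 1, \<dots>, T N\<close> act on the subspace \<open>X\<close>; open sets are those of \<open>X\<close>.\<close>

definition disjoint_hypercyclic ::
    "nat set set \<Rightarrow> 'a::topological_space set \<Rightarrow> nat \<Rightarrow> (nat \<Rightarrow> 'a \<Rightarrow> 'a) \<Rightarrow> bool" where
  "disjoint_hypercyclic \<A> X N T \<longleftrightarrow>
     (\<exists>x\<in>X. \<forall>V. (\<forall>s\<in>{1..N}. openin (top_of_set X) (V s) \<and> V s \<noteq> {}) \<longrightarrow>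
        {n. n \<ge> 1 \<and> (\<forall>s\<in>{1..N}. (T s ^^ n) x \<in> V s)} \<in> \<A>)"

definition weakly_partition_regular ::
    "nat set set \<Rightarrow> nat \<Rightarrow> (nat \<Rightarrow> nat \<Rightarrow> nat) \<Rightarrow> bool" where
  "weakly_partition_regular \<A> N f \<longleftrightarrow>
     (\<forall>B :: nat \<Rightarrow> nat set. (\<forall>l\<ge>1. B l \<in> \<A>) \<longrightarrow>
        (\<exists>A :: nat \<Rightarrow> nat set. (\<forall>l\<ge>1. A l \<in> \<A> \<and> A l \<subseteq> B l) \<and>
           (\<forall>l\<ge>1. \<forall>k\<ge>1. \<forall>m\<in>A l. \<forall>n\<in>A k. m \<noteq> n \<longrightarrow>
              (\<forall>s\<in>{1..N}. \<forall>t\<in>{1..N}. (f s ^^ m) ` {1..l} \<inter> (f t ^^ n) ` {1..k} = {}))))"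

text \<open>\<open>iter_inv f n\<close> is the inverse of \<open>f ^^ n\<close>, restricted to \<open>{1..}\<close>, on its range.\<close>

definition iter_inv :: "(nat \<Rightarrow> nat) \<Rightarrow> nat \<Rightarrow> nat \<Rightarrow> nat" where
  "iter_inv f n = inv_into {1..} (f ^^ n)"

definition weight_prod ::
    "(nat \<Rightarrow> nat) \<Rightarrow> (nat \<Rightarrow> 'k::{real_normed_field,euclidean_space}) \<Rightarrow> nat \<Rightarrow> nat \<Rightarrow> 'k" where
  "weight_prod f w l n = (\<Prod>\<nu>=1..n. w ((f ^^ \<nu>) l))"

end

theory Submission
  imports Defs
begin

text \<open>
  The \<open>j\<close>-th coordinate of \<open>T\<^sub>s\<^sup>n x\<close> is \<open>W\<^sup>s\<^bsub>j,n\<^esub> * x\<^bsub>i\<^esub>\<close> with \<open>i = f\<^sub>s\<^sup>n(j)\<close>. Hence, when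
  \<open>f\<^sub>t\<^sup>m(i) = f\<^sub>s\<^sup>n(i')\<close>, coordinate \<open>i\<close> of \<open>T\<^sub>t\<^sup>m x\<close> and coordinate \<open>i'\<close> of \<open>T\<^sub>s\<^sup>n x\<close> read the
  same entry of \<open>x\<close>, and their ratio is a ratio of weights. All conditions of the theorem express
  what orbits close to prescribed vectors force on such ratios, and conversely.

  Both directions run through one sequence of target arrays \<open>z p\<close> (rows in \<open>c\<^sub>0\<close>, no vanishing
  coordinate) that approximates every array of rows in \<open>c\<^sub>0\<close> infinitely often
  (\<open>universal_target_arrays\<close>).

  If \<open>x\<close> is a disjoint hypercyclic vector, let \<open>A L\<close> be the set of times at which the orbits are
  close to the first \<open>L\<close> coordinates of a large multiple of \<open>z L\<close>. The first \<open>L\<close> coordinates of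
  the orbits are then larger than \<open>L\<close> and the later ones smaller than \<open>1 / L\<close>, which bounds the
  ratios as required. Divergence of the weights follows since the entries of \<open>x\<close> tend to zero, and
  the last condition since \<open>z L\<close> comes close to any prescribed array, while the scaling factor
  cancels in ratios (\<open>weight_conditions_of_disjoint_hypercyclic\<close>).

  For the converse, stages \<open>p = 0, 1, \<dots>\<close> are processed. The last condition, applied to \<open>z p\<close> and a
  large length \<open>l p\<close>, yields \<open>L p \<ge> l p\<close> (\<open>stages_exist\<close>). Discarding finitely many
  times, which leaves the four families invariant (\<open>density_family_almost_superset\<close>), the weights at
  the times in \<open>A (L p)\<close> may be assumed large, and weak partition regularity makes the blocks
  \<open>f\<^sub>s\<^sup>n([L p])\<close> of different times disjoint. The vector \<open>x\<close> has the entry \<open>z p s j / W\<^sup>s\<^bsub>j,n\<^esub>\<close> at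
  \<open>f\<^sub>s\<^sup>n(j)\<close> for \<open>j \<le> l p\<close> and times \<open>n\<close> of stage \<open>p\<close>, with an arbitrary choice of \<open>s\<close> where several
  values compete (\<open>block_vector_exists\<close>). At such a time \<open>T\<^sub>s\<^sup>n x\<close> is within \<open>2 / (p + 1)\<close> of row
  \<open>s\<close> of \<open>z p\<close>: blocks of the same time are controlled by the last condition and blocks of other
  times by the first three (\<open>disjoint_hypercyclic_of_weight_conditions\<close>).
\<close>

section \<open>Families of sets of positive density\<close>

lemma quotient_le_add:
  assumes "u \<le> v + c"
  shows "ereal (real u / real M) \<le> ereal (real c / real M) + ereal (real v / real M)"
proof -
  have "real u / real M \<le> (real v + real c) / real M"
    using assms by (intro divide_right_mono) auto
  then show ?thesis by (simp add: add_divide_distrib add.commute)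
qed

lemma const_div_tendsto_0: "(\<lambda>M. ereal (real c / real M)) \<longlonglongrightarrow> 0"
  by (simp add: zero_ereal_def lim_const_over_n)

lemma limsup_pos_bounded_change:
  fixes u v :: "nat \<Rightarrow> nat"
  assumes "limsup (\<lambda>M. ereal (real (u M) / real M)) > 0" "\<And>M. u M \<le> v M + c"
  shows "limsup (\<lambda>M. ereal (real (v M) / real M)) > 0"
proof -
  have "limsup (\<lambda>M. ereal (real (u M) / real M)) \<le>
        limsup (\<lambda>M. ereal (real c / real M) + ereal (real (v M) / real M))"
    by (intro Limsup_mono always_eventually allI quotient_le_add assms(2))
  also have "\<dots> = limsup (\<lambda>M. ereal (real (v M) / real M))"
    by (subst ereal_limsup_lim_add[OF const_div_tendsto_0]) simp_all
  finally show ?thesis using assms(1) by simp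
qed

lemma liminf_pos_bounded_change:
  fixes u v :: "nat \<Rightarrow> nat"
  assumes "liminf (\<lambda>M. ereal (real (u M) / real M)) > 0" "\<And>M. u M \<le> v M + c"
  shows "liminf (\<lambda>M. ereal (real (v M) / real M)) > 0"
proof -
  have "liminf (\<lambda>M. ereal (real (u M) / real M)) \<le>
        liminf (\<lambda>M. ereal (real c / real M) + ereal (real (v M) / real M))"
    by (intro Liminf_mono always_eventually allI quotient_le_add assms(2))
  also have "\<dots> = liminf (\<lambda>M. ereal (real (v M) / real M))"
    by (subst ereal_liminf_lim_add[OF const_div_tendsto_0]) simp_all
  finally show ?thesis using assms(1) by simp
qed

lemma card_Int_le_add_card_Diff:
  assumes "finite F" "finite (A - B)"
  shows "card (A \<inter> F) \<le> card (B \<inter> F) + card (A - B)"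
proof -
  have "card (A \<inter> F) \<le> card ((B \<inter> F) \<union> (A - B))"
    using assms by (intro card_mono) auto
  also have "\<dots> \<le> card (B \<inter> F) + card (A - B)" by (rule card_Un_le)
  finally show ?thesis .
qed

text \<open>
  The four families are insensitive to finite changes because a bounded error in the counting
  function contributes \<open>c / M \<rightarrow> 0\<close> to the quotients whose lower or upper limit is the density.
  For the upper Banach density the error is the same for all windows and so passes to their maximum.
\<close>

lemma density_family_almost_superset:
  assumes "\<A> \<in> {A_inf, A_uBd, A_ud, A_ld}" "A \<in> \<A>" "B \<subseteq> {1..}" "finite (A - B)"
  shows "B \<in> \<A>"
proof -
  have count: "card {n \<in> {1..M}. n \<in> A} \<le> card {n \<in> {1..M}. n \<in> B} + card (A - B)" for M
  proof -
    have "{n \<in> {1..M}. n \<in> C} = C \<inter> {1..M}" for C by blast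
    then show ?thesis using card_Int_le_add_card_Diff[of "{1..M}" A B] assms(4) by simp
  qed
  let ?m = "\<lambda>A M. Max ((\<lambda>k. card (A \<inter> {k+1..k+M})) ` {1..})"
  have fin: "finite ((\<lambda>k. card (C \<inter> {k+1..k+M})) ` {1..})" for C :: "nat set" and M
  proof (rule finite_subset)
    show "(\<lambda>k. card (C \<inter> {k+1..k+M})) ` {1..} \<subseteq> {..M}"
    proof clarify
      fix k
      have "card (C \<inter> {k+1..k+M}) \<le> card {k+1..k+M}" by (intro card_mono) auto
      then show "card (C \<inter> {k+1..k+M}) \<le> M" by simp
    qed
  qed simp
  have count_max: "?m A M \<le> ?m B M + card (A - B)" for M
  proof (rule Max.boundedI[OF fin])
    fix a assume "a \<in> (\<lambda>k. card (A \<inter> {k+1..k+M})) ` {1..}"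
    then obtain k where k: "k \<ge> 1" "a = card (A \<inter> {k+1..k+M})" by auto
    have "a \<le> card (B \<inter> {k+1..k+M}) + card (A - B)"
      unfolding k(2) by (intro card_Int_le_add_card_Diff assms(4)) simp
    also have "card (B \<inter> {k+1..k+M}) \<le> ?m B M"
      using k(1) by (intro Max_ge[OF fin]) auto
    finally show "a \<le> ?m B M + card (A - B)" by simp
  qed auto
  consider "\<A> = A_inf" | "\<A> = A_uBd" | "\<A> = A_ud" | "\<A> = A_ld" using assms(1) by blast
  then show ?thesis
  proof cases
    case 1
    have "finite A" if "finite B"
      using finite_subset[of A "(A - B) \<union> B"] that assms(4) by auto
    then show ?thesis using 1 assms by (auto simp: A_inf_def)
  next
    case 2
    then show ?thesis
      using assms(2,3) limsup_pos_bounded_change[OF _ count_max]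
      by (auto simp: A_uBd_def upper_Banach_dens_def)
  next
    case 3
    then show ?thesis
      using assms(2,3) limsup_pos_bounded_change[OF _ count]
      by (auto simp: A_ud_def upper_dens_def)
  next
    case 4
    then show ?thesis
      using assms(2,3) liminf_pos_bounded_change[OF _ count]
      by (auto simp: A_ld_def lower_dens_def)
  qed
qed

lemma density_family_subset:
  assumes "\<A> \<in> {A_inf, A_uBd, A_ud, A_ld}" "A \<in> \<A>"
  shows "A \<subseteq> {1..}"
  using assms by (auto simp: A_inf_def A_uBd_def A_ud_def A_ld_def)

lemma density_family_infinite:
  assumes "\<A> \<in> {A_inf, A_uBd, A_ud, A_ld}" "A \<in> \<A>"
  shows "infinite A"
proof
  assume "finite A"
  then have "{} \<in> \<A>" using density_family_almost_superset[OF assms, of "{}"] by auto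
  moreover have "(\<lambda>k::nat. 0::nat) ` {1..} = {0}" by auto
  ultimately show False
    using assms(1)
    by (auto simp: A_inf_def A_uBd_def A_ud_def A_ld_def upper_Banach_dens_def upper_dens_def
        lower_dens_def Limsup_const Liminf_const zero_ereal_def[symmetric])
qed


section \<open>Iterates of pseudo-shifts\<close>

lemma is_pseudo_shift_funpow_ge:
  assumes "is_pseudo_shift f w" "j \<ge> 1"
  shows "(f ^^ n) j \<ge> j + n"
proof (induction n)
  case (Suc n)
  have "f ((f ^^ n) j) > (f ^^ n) j"
    using Suc assms(2) by (intro is_pseudo_shift_ge[OF assms(1)]) simp
  with Suc show ?case by simp
qed simp

lemma is_pseudo_shift_inj_funpow:
  assumes "is_pseudo_shift f w"
  shows "inj_on (f ^^ n) {1..}"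
proof (induction n)
  case (Suc n)
  have "inj_on f {1..}"
    using assms by (auto simp: is_pseudo_shift_def intro: strict_mono_on_imp_inj_on)
  moreover have "(f ^^ n) ` {1..} \<subseteq> {1..}"
    using le_trans[OF _ is_pseudo_shift_funpow_ge[OF assms]] by (simp add: image_subset_iff)
  ultimately have "inj_on f ((f ^^ n) ` {1..})" by (rule inj_on_subset)
  then show ?case unfolding funpow.simps by (rule comp_inj_on[OF Suc])
qed simp

lemma iter_inv_funpow:
  assumes "is_pseudo_shift f w" "j \<ge> 1"
  shows "iter_inv f n ((f ^^ n) j) = j"
  unfolding iter_inv_def
  using is_pseudo_shift_inj_funpow[OF assms(1)] assms(2) by (intro inv_into_f_f) auto

lemma weight_prod_Suc_left: "weight_prod f w j (Suc n) = w (f j) * weight_prod f w (f j) n"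
proof -
  have "weight_prod f w j (Suc n) = w (f j) * (\<Prod>\<nu>=Suc 1..Suc n. w ((f ^^ \<nu>) j))"
    unfolding weight_prod_def by (subst prod.atLeast_Suc_atMost) auto
  also have "(\<Prod>\<nu>=Suc 1..Suc n. w ((f ^^ \<nu>) j)) = weight_prod f w (f j) n"
    unfolding weight_prod_def
    by (subst prod.shift_bounds_cl_Suc_ivl) (simp add: funpow_swap1)
  finally show ?thesis .
qed

lemma weight_prod_nonzero_prefix:
  assumes "weight_prod f w j n \<noteq> 0" "m \<le> n"
  shows "weight_prod f w j m \<noteq> 0"
  using assms by (auto simp: weight_prod_def)

lemma pseudo_shift_funpow_apply:
  assumes "is_pseudo_shift f w" "j \<ge> 1"
  shows "apply_bcontfun ((pseudo_shift f w ^^ n) x) j =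
           weight_prod f w j n * apply_bcontfun x ((f ^^ n) j)"
  using assms(2)
proof (induction n arbitrary: j)
  case 0
  then show ?case by (simp add: weight_prod_def)
next
  case (Suc n)
  have "f j \<ge> 1" using is_pseudo_shift_ge[OF assms(1) Suc.prems] by simp
  then show ?case
    using Suc.IH[of "f j"] Suc.prems
    by (simp add: pseudo_shift_apply[OF assms(1)] weight_prod_Suc_left funpow_swap1[of f])
qed

lemma pseudo_shift_funpow_in_c0:
  assumes "is_pseudo_shift f w" "x \<in> c0"
  shows "(pseudo_shift f w ^^ n) x \<in> c0"
  by (induction n) (auto intro: assms pseudo_shift_in_c0)

lemma tendsto_0_mem_bcontfun:
  fixes x :: "nat \<Rightarrow> 'k::real_normed_vector"
  assumes "x \<longlonglongrightarrow> 0"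
  shows "x \<in> bcontfun"
proof -
  obtain B where "\<And>n. norm (x n) \<le> B"
    using convergent_imp_bounded[OF assms] by (auto simp: bounded_iff)
  then show ?thesis by (intro bcontfun_normI[where b = B]) auto
qed


section \<open>A universal sequence of target arrays\<close>

text \<open>
  Rows of an array play the role of vectors in \<open>c\<^sub>0\<close>. Arrays given by finitely many entries from a
  countable dense set of non-zero scalars are countable in number. Their tails are filled with
  \<open>1 / (r + j + 1)\<close>, which keeps every coordinate non-zero; letting the index \<open>r\<close> grow makes the tail
  negligible and at the same time makes every approximant recur infinitely often.
\<close>

lemma universal_target_arrays:
  obtains z :: "nat \<Rightarrow> nat \<Rightarrow> nat \<Rightarrow> 'k::{real_normed_field,euclidean_space}"
  where "\<And>p s j. s \<in> {1..N} \<Longrightarrow> z p s j \<noteq> 0" "\<And>p s. z p s \<longlonglongrightarrow> 0"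
    "\<And>a \<eta> P. \<lbrakk>\<And>s. s \<in> {1..N} \<Longrightarrow> a s \<longlonglongrightarrow> 0; \<eta> > 0\<rbrakk> \<Longrightarrow>
       \<exists>p\<ge>P. \<forall>s\<in>{1..N}. \<forall>j\<ge>1. norm (z p s j - a s j) \<le> \<eta>"
proof -
  obtain D0 :: "'k set" where D0: "countable D0" "\<And>X. open X \<Longrightarrow> X \<noteq> {} \<Longrightarrow> \<exists>d\<in>D0. d \<in> X"
    by (rule countable_dense_setE) blast
  define D where "D = D0 - {0}"
  have dense: "\<exists>d\<in>D. norm (d - c) < \<eta>" if "\<eta> > 0" for c and \<eta> :: real
  proof -
    \<comment> \<open>The scalar field has no isolated points, so a dense set stays dense without zero.\<close>
    have "open (ball c \<eta> - {0})" by (intro open_delete open_ball)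
    moreover have "ball c \<eta> - {0} \<noteq> {}"
    proof (cases "c = 0")
      case True
      then have "of_real (\<eta> / 2) \<in> ball c \<eta> - {0}" using that by (simp add: dist_norm)
      then show ?thesis by blast
    next
      case False
      then have "c \<in> ball c \<eta> - {0}" using that by simp
      then show ?thesis by blast
    qed
    ultimately obtain d where "d \<in> D0" "d \<in> ball c \<eta> - {0}" using D0(2) by blast
    then show ?thesis by (auto simp: D_def dist_norm norm_minus_commute)
  qed
  define C where
    "C = (SIGMA l:(UNIV::nat set). PiE ({1..N} \<times> {1..l}) (\<lambda>_. D)) \<times> (UNIV :: nat set)"
  have "countable C"
    unfolding C_def using D0(1) by (intro countable_SIGMA countable_PiE) (auto simp: D_def)
  moreover obtain d where "d \<in> D" using dense[of 1 0] by auto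
  then have "((0, restrict (\<lambda>_. d) ({1..N} \<times> {1..0})), 0) \<in> C" by (auto simp: C_def)
  then have "C \<noteq> {}" by blast
  ultimately have enum: "range (from_nat_into C) = C"
    by (simp add: range_from_nat_into)
  define arr :: "(nat \<times> (nat \<times> nat \<Rightarrow> 'k)) \<times> nat \<Rightarrow> nat \<Rightarrow> nat \<Rightarrow> 'k" where
    "arr = (\<lambda>((l, b), r) s j. if 1 \<le> j \<and> j \<le> l then b (s, j) else of_real (1 / real (Suc (r + j))))"
  define z where "z = (\<lambda>p. arr (from_nat_into C p))"
  show thesis
  proof
    fix p s j assume s: "s \<in> {1..N}"
    obtain l b r where c: "from_nat_into C p = ((l, b), r)" by (metis prod.exhaust)
    then have "((l, b), r) \<in> C" using enum by (metis rangeI)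
    then have b: "b \<in> PiE ({1..N} \<times> {1..l}) (\<lambda>_. D)" by (simp add: C_def)
    have "b (s, j) \<noteq> 0" if "1 \<le> j" "j \<le> l"
    proof -
      have "b (s, j) \<in> D" using PiE_mem[OF b, of "(s, j)"] s that by simp
      then show ?thesis by (simp add: D_def)
    qed
    then show "z p s j \<noteq> 0" by (auto simp: z_def c arr_def simp del: of_real_divide of_nat_Suc)
  next
    fix p s
    obtain l b r where c: "from_nat_into C p = ((l, b), r)" by (metis prod.exhaust)
    have "(\<lambda>j. of_real (1 / real (Suc (r + j))) :: 'k) \<longlonglongrightarrow> of_real 0"
    proof (intro tendsto_of_real)
      have "(\<lambda>n. 1 / real (Suc n)) \<longlonglongrightarrow> 0" by (intro LIMSEQ_Suc lim_1_over_n)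
      from LIMSEQ_ignore_initial_segment[OF this, of r]
      show "(\<lambda>j. 1 / real (Suc (r + j))) \<longlonglongrightarrow> 0" by (simp only: add.commute[of r])
    qed
    moreover have "\<forall>\<^sub>F j in sequentially. of_real (1 / real (Suc (r + j))) = z p s j"
      using eventually_gt_at_top[of l] by eventually_elim (auto simp: z_def c arr_def)
    ultimately show "z p s \<longlonglongrightarrow> 0" by (simp add: tendsto_cong)
  next
    fix a :: "nat \<Rightarrow> nat \<Rightarrow> 'k" and \<eta> :: real and P
    assume a: "\<And>s. s \<in> {1..N} \<Longrightarrow> a s \<longlonglongrightarrow> 0" and \<eta>: "\<eta> > 0"
    have "\<forall>\<^sub>F j in sequentially. \<forall>s\<in>{1..N}. norm (a s j) < \<eta> / 2"
      using a \<eta> by (intro eventually_ball_finite ballI order_tendstoD(2)[OF tendsto_norm_zero]) auto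
    then obtain l where l: "\<And>j s. j \<ge> l \<Longrightarrow> s \<in> {1..N} \<Longrightarrow> norm (a s j) < \<eta> / 2"
      unfolding eventually_sequentially by blast
    have "\<forall>q. \<exists>d\<in>D. norm (d - a (fst q) (snd q)) < \<eta>" using dense[OF \<eta>] by blast
    then obtain h where h: "\<And>q. h q \<in> D" "\<And>q. norm (h q - a (fst q) (snd q)) < \<eta>" by metis
    define b where "b = restrict h ({1..N} \<times> {1..l})"
    have mem: "((l, b), r) \<in> C" for r using h(1) by (auto simp: C_def b_def)
    obtain R where R: "1 / \<eta> * 2 < real R" using reals_Archimedean2 by blast
    \<comment> \<open>Infinitely many tails \<open>r\<close> are admissible, so one of them has an index beyond \<open>P\<close>.\<close>
    have "inj_on (\<lambda>r. ((l, b), r)) {R..}" by (auto simp: inj_on_def)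
    then have "infinite ((\<lambda>r. ((l, b), r)) ` {R..})" by (simp add: finite_image_iff infinite_Ici)
    then have "\<not> (\<lambda>r. ((l, b), r)) ` {R..} \<subseteq> from_nat_into C ` {..<P}"
      using finite_subset by blast
    then obtain r where r: "r \<ge> R" "((l, b), r) \<notin> from_nat_into C ` {..<P}" by auto
    obtain p where p: "from_nat_into C p = ((l, b), r)" using mem[of r] enum by (metis imageE)
    have "p \<ge> P" using r(2) p by (metis imageI lessThan_iff not_le)
    moreover have "norm (z p s j - a s j) \<le> \<eta>" if "s \<in> {1..N}" "j \<ge> 1" for s j
    proof (cases "j \<le> l")
      case True
      then show ?thesis
        using that h(2)[of "(s, j)"] by (auto simp: z_def p arr_def b_def)
    next
      case False
      have "2 / \<eta> < real (Suc (r + j))" using R r(1) by simp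
      then have "1 / real (Suc (r + j)) \<le> \<eta> / 2" using \<eta> by (simp add: field_simps)
      moreover have "norm (z p s j) = 1 / real (Suc (r + j))"
        using False by (simp add: z_def p arr_def norm_divide del: of_nat_Suc)
      ultimately show ?thesis
        using norm_triangle_ineq4[of "z p s j" "a s j"] l[of j s] False that by simp
    qed
    ultimately show "\<exists>p\<ge>P. \<forall>s\<in>{1..N}. \<forall>j\<ge>1. norm (z p s j - a s j) \<le> \<eta>" by blast
  qed
qed


section \<open>Weight conditions for a tuple of pseudo-shifts\<close>

locale pseudo_shift_tuple =
  fixes N :: nat
    and f :: "nat \<Rightarrow> nat \<Rightarrow> nat"
    and w :: "nat \<Rightarrow> nat \<Rightarrow> 'k::{real_normed_field,euclidean_space}"
  assumes shift: "s \<in> {1..N} \<Longrightarrow> is_pseudo_shift (f s) (w s)"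
begin

abbreviation W :: "nat \<Rightarrow> nat \<Rightarrow> nat \<Rightarrow> 'k" where
  "W s \<equiv> weight_prod (f s) (w s)"

abbreviation T :: "nat \<Rightarrow> (nat \<Rightarrow>\<^sub>C 'k) \<Rightarrow> (nat \<Rightarrow>\<^sub>C 'k)" where
  "T s \<equiv> pseudo_shift (f s) (w s)"

text \<open>
  A point of \<open>f\<^sub>s\<^sup>n(J)\<close> is written as \<open>f\<^sub>s\<^sup>n(i)\<close> with \<open>i \<in> J\<close>, so that no inverse of an iterate occurs:
  a coincidence \<open>f\<^sub>t\<^sup>m(i) = f\<^sub>s\<^sup>n(i')\<close> means that coordinate \<open>i\<close> of \<open>T\<^sub>t\<^sup>m x\<close> and coordinate \<open>i'\<close>
  of \<open>T\<^sub>s\<^sup>n x\<close> are read off the same coordinate of \<open>x\<close>.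
\<close>

definition weight_conditions :: "(nat \<Rightarrow> nat set) \<Rightarrow> (nat \<Rightarrow> real) \<Rightarrow> bool" where
  "weight_conditions A \<epsilon> \<longleftrightarrow>
     (\<forall>k\<ge>1. \<epsilon> k > 0) \<and> \<epsilon> \<longlonglongrightarrow> 0 \<and>
     (\<forall>k\<ge>1. \<forall>j\<in>{1..k}. \<forall>s\<in>{1..N}.
        filterlim (\<lambda>n. norm (W s j n)) at_top (inf sequentially (principal (A k)))) \<and>
     (\<forall>l\<ge>1. \<forall>k\<ge>1. \<forall>n\<in>A l. \<forall>m\<in>A k. \<forall>s\<in>{1..N}. \<forall>i\<in>{1..k}. \<forall>i'>l.
        (f s ^^ m) i = (f s ^^ n) i' \<longrightarrow> norm (W s i' n) / norm (W s i m) \<le> min (\<epsilon> l) (\<epsilon> k)) \<and>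
     (\<forall>l\<ge>1. \<forall>i\<in>{1..l}. \<forall>k\<ge>1. \<forall>n\<in>A k. \<forall>s\<in>{1..N}. \<forall>t\<in>{1..N}. s \<noteq> t \<longrightarrow>
        (\<forall>m\<in>A l - {n}. \<forall>i'>k. (f t ^^ m) i = (f s ^^ n) i' \<longrightarrow>
           norm (W s i' n) / norm (W t i m) \<le> \<epsilon> l)) \<and>
     (\<forall>k\<ge>1. \<forall>l>k. \<forall>i\<in>{1..k}. \<forall>n\<in>A l. \<forall>s\<in>{1..N}. \<forall>t\<in>{1..N}. s \<noteq> t \<longrightarrow>
        (\<forall>m\<in>A k. \<forall>i'>l. (f t ^^ m) i = (f s ^^ n) i' \<longrightarrow>
           norm (W s i' n) / norm (W t i m) \<le> \<epsilon> l)) \<and>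
     (\<forall>l\<ge>1. \<forall>a :: nat \<Rightarrow> nat \<Rightarrow> 'k. \<forall>\<delta>>0.
        (\<forall>s\<in>{1..N}. \<forall>j\<in>{1..l}. a s j \<noteq> 0) \<longrightarrow>
        (\<exists>L\<ge>l. \<forall>s\<in>{1..N}. \<forall>t\<in>{1..N}. s \<noteq> t \<longrightarrow> (\<forall>n\<in>A L. \<forall>i\<in>{1..l}.
          (\<forall>i'\<in>{1..l}. (f t ^^ n) i = (f s ^^ n) i' \<longrightarrow>
             norm (W s i' n / W t i n - a s i' / a t i) \<le> \<delta>) \<and>
          (\<forall>i'>l. (f t ^^ n) i = (f s ^^ n) i' \<longrightarrow>
             norm (W s i' n) / norm (W t i n) \<le> \<delta>))))"


section \<open>From a disjoint hypercyclic vector to the weight conditions\<close>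

lemma norm_divide_le_of_products:
  fixes u v x :: 'k
  assumes "norm (u * x) \<le> d" "c \<le> norm (v * x)" "c > 0"
  shows "norm u / norm v \<le> d / c"
proof -
  have "x \<noteq> 0" using assms(2,3) by auto
  then have "norm u / norm v = norm (u * x) / norm (v * x)"
    unfolding norm_mult by (intro mult_divide_mult_cancel_right[symmetric]) simp
  also have "\<dots> \<le> d / c" by (rule frac_le[OF order_trans[OF norm_ge_zero assms(1)] assms(1,3,2)])
  finally show ?thesis .
qed

text \<open>
  The numerator may be close to \<open>c = 0\<close>; then the quotient itself is small, so that one tolerance
  serves both parts of the last weight condition.
\<close>

lemma eventually_quotient_close:
  fixes b c :: 'k
  assumes "b \<noteq> 0" "\<delta> > 0"
  shows "\<forall>\<^sub>F \<eta> in at_right (0::real). \<forall>u v.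
           norm (u - c) \<le> \<eta> \<longrightarrow> norm (v - b) \<le> \<eta> \<longrightarrow> norm (u / v - c / b) \<le> \<delta>"
proof -
  have "isCont (\<lambda>q. fst q / snd q) (c, b)" using assms(1) by (intro continuous_intros) auto
  then obtain d where d: "d > 0"
    "\<And>q. dist q (c, b) < d \<Longrightarrow> dist (fst q / snd q) (c / b) < \<delta>"
    using assms(2) unfolding continuous_at_eps_delta by (metis fst_conv snd_conv)
  have "\<forall>\<^sub>F \<eta> in at_right (0::real). \<eta> < d / 2"
    using d(1) by (intro order_tendstoD[OF tendsto_ident_at]) auto
  then show ?thesis
  proof eventually_elim
    case (elim \<eta>)
    show ?case
    proof (intro allI impI)
      fix u v assume uv: "norm (u - c) \<le> \<eta>" "norm (v - b) \<le> \<eta>"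
      have "dist (u, v) (c, b) \<le> norm (u - c) + norm (v - b)"
        using norm_Pair_le[of "u - c" "v - b"] by (simp add: dist_norm)
      then have "dist (u, v) (c, b) < d" using uv elim by simp
      from d(2)[OF this] show "norm (u / v - c / b) \<le> \<delta>" by (simp add: dist_norm)
    qed
  qed
qed

text \<open>
  Only ratios of target coordinates enter the last condition, so a target may be multiplied by a
  large scalar. Taking \<open>A L\<close> to be the set of times at which the orbits are within \<open>1 / (L + 1)\<close> of a
  target cut off after \<open>L\<close> and scaled so that its first \<open>L\<close> entries have modulus at least \<open>L + 2\<close>,
  the first \<open>L\<close> coordinates of the orbit have modulus at least \<open>L + 1\<close> and all later ones at most \<open>1 / (L + 1)\<close>.
  When two orbit coordinates share a coordinate of \<open>x\<close>, the ratio of the weights equals the ratio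
  of these orbit coordinates.
\<close>

lemma weight_conditions_of_disjoint_hypercyclic:
  assumes fam: "\<A> \<in> {A_inf, A_uBd, A_ud, A_ld}"
    and hc: "disjoint_hypercyclic \<A> c0 N T"
  shows "\<exists>A \<epsilon>. (\<forall>k\<ge>1. A k \<in> \<A>) \<and> weight_conditions A \<epsilon>"
proof -
  from hc[unfolded disjoint_hypercyclic_def] obtain x where x: "x \<in> c0"
    and hc_x: "\<forall>V. (\<forall>s\<in>{1..N}. openin (top_of_set c0) (V s) \<and> V s \<noteq> {}) \<longrightarrow>
      {n. n \<ge> 1 \<and> (\<forall>s\<in>{1..N}. (T s ^^ n) x \<in> V s)} \<in> \<A>" ..
  have hits: "{n. n \<ge> 1 \<and> (\<forall>s\<in>{1..N}. (T s ^^ n) x \<in> V s)} \<in> \<A>"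
    if "\<And>s. s \<in> {1..N} \<Longrightarrow> openin (top_of_set c0) (V s) \<and> V s \<noteq> {}" for V
    using hc_x[rule_format, of V] that by simp
  obtain z :: "nat \<Rightarrow> nat \<Rightarrow> nat \<Rightarrow> 'k" where z:
    "\<And>p s j. s \<in> {1..N} \<Longrightarrow> z p s j \<noteq> 0"
    "\<And>a \<eta> P. \<lbrakk>\<And>s. s \<in> {1..N} \<Longrightarrow> a s \<longlonglongrightarrow> 0; \<eta> > 0\<rbrakk> \<Longrightarrow>
       \<exists>p\<ge>P. \<forall>s\<in>{1..N}. \<forall>j\<ge>1. norm (z p s j - a s j) \<le> \<eta>"
    by (rule universal_target_arrays[of N]) blast
  have "\<exists>c\<ge>1. \<forall>s\<in>{1..N}. \<forall>j\<in>{1..L}. real L + 2 \<le> c * norm (z L s j)" for L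
  proof (intro exI conjI ballI)
    \<comment> \<open>The sum bounds the finitely many scaling factors that the single entries require.\<close>
    let ?h = "\<lambda>q. (real L + 2) / norm (z L (fst q) (snd q))"
    let ?c = "1 + (\<Sum>q\<in>{1..N} \<times> {1..L}. ?h q)"
    show "?c \<ge> 1" by (simp add: sum_nonneg)
    fix s j assume sj: "s \<in> {1..N}" "j \<in> {1..L}"
    have "?h (s, j) \<le> (\<Sum>q\<in>{1..N} \<times> {1..L}. ?h q)"
      using sj by (intro member_le_sum) auto
    then have "?h (s, j) \<le> ?c" by simp
    then show "real L + 2 \<le> ?c * norm (z L s j)"
      using z(1)[OF sj(1), of L j] by (simp add: pos_divide_le_eq)
  qed
  then obtain c where c: "\<And>L. c L \<ge> 1"
    "\<And>L s j. \<lbrakk>s \<in> {1..N}; j \<in> {1..L}\<rbrakk> \<Longrightarrow> real L + 2 \<le> c L * norm (z L s j)"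
    by metis
  define y where "y L s j = (if j \<in> {1..L} then of_real (c L) * z L s j else 0)" for L s j
  have y_lim: "y L s \<longlonglongrightarrow> 0" for L s
    by (rule tendsto_eventually, use eventually_gt_at_top[of L] in eventually_elim)
       (simp add: y_def)
  have y_apply: "apply_bcontfun (Bcontfun (y L s)) = y L s" for L s
    by (rule Bcontfun_inverse[OF tendsto_0_mem_bcontfun[OF y_lim]])
  define \<epsilon> where "\<epsilon> k = 1 / (real k + 1)" for k :: nat
  have \<epsilon>_pos: "\<epsilon> k > 0" for k by (simp add: \<epsilon>_def)
  have "(\<lambda>k. 1 / real (Suc k)) \<longlonglongrightarrow> 0" by (intro LIMSEQ_Suc lim_1_over_n)
  then have \<epsilon>_lim: "\<epsilon> \<longlonglongrightarrow> 0" unfolding \<epsilon>_def by (simp only: of_nat_Suc add.commute)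
  define A where "A L = {n. n \<ge> 1 \<and>
    (\<forall>s\<in>{1..N}. (T s ^^ n) x \<in> c0 \<inter> ball (Bcontfun (y L s)) (\<epsilon> L))}" for L
  have A_fam: "A L \<in> \<A>" for L
    unfolding A_def
  proof (rule hits)
    fix s
    have "Bcontfun (y L s) \<in> c0 \<inter> ball (Bcontfun (y L s)) (\<epsilon> L)"
      using y_lim \<epsilon>_pos by (auto simp: c0_def y_apply y_def)
    then show "openin (top_of_set c0) (c0 \<inter> ball (Bcontfun (y L s)) (\<epsilon> L)) \<and>
        c0 \<inter> ball (Bcontfun (y L s)) (\<epsilon> L) \<noteq> {}"
      by (auto intro: openin_open_Int)
  qed
  define X where "X = apply_bcontfun x"
  have close: "norm (W s j n * X ((f s ^^ n) j) - y L s j) \<le> \<epsilon> L"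
    if "n \<in> A L" "s \<in> {1..N}" "j \<ge> 1" for L n s j
  proof -
    have "dist (apply_bcontfun ((T s ^^ n) x) j) (y L s j) \<le> dist ((T s ^^ n) x) (Bcontfun (y L s))"
      using dist_bounded[of "(T s ^^ n) x" j "Bcontfun (y L s)"] by (simp add: y_apply)
    also have "\<dots> \<le> \<epsilon> L"
      using that(1,2) unfolding A_def by (simp add: dist_commute less_imp_le)
    finally show ?thesis
      using that by (simp add: X_def dist_norm pseudo_shift_funpow_apply[OF shift])
  qed
  have low: "real L + 1 \<le> norm (W s j n * X ((f s ^^ n) j))"
    if "n \<in> A L" "s \<in> {1..N}" "j \<in> {1..L}" for L n s j
  proof -
    have "real L + 2 \<le> norm (y L s j)"
      using c(2)[OF that(2,3)] c(1)[of L] that(3) by (simp add: y_def norm_mult)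
    moreover have "\<epsilon> L \<le> 1" by (simp add: \<epsilon>_def)
    ultimately show ?thesis
      using close[of n L s j] that norm_triangle_ineq2[of "y L s j" "W s j n * X ((f s ^^ n) j)"]
      by (simp add: norm_minus_commute)
  qed
  have up: "norm (W s j n * X ((f s ^^ n) j)) \<le> \<epsilon> L"
    if "n \<in> A L" "s \<in> {1..N}" "j > L" for L n s j
    using close[of n L s j] that by (simp add: y_def)
  have ratio: "norm (W s i' n) / norm (W t i m) \<le> \<epsilon> l \<and> norm (W s i' n) / norm (W t i m) \<le> \<epsilon> k"
    if "n \<in> A l" "m \<in> A k" "s \<in> {1..N}" "t \<in> {1..N}" "i \<in> {1..k}" "i' > l"
      "(f t ^^ m) i = (f s ^^ n) i'" for l k n m s t i i'
  proof -
    have "norm (W s i' n) / norm (W t i m) \<le> \<epsilon> l / (real k + 1)"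
      using up[OF that(1,3,6)] low[OF that(2,4,5)] that(7)
      by (intro norm_divide_le_of_products) auto
    moreover have "\<epsilon> l / (real k + 1) \<le> \<epsilon> l / 1"
      using \<epsilon>_pos[of l] by (intro divide_left_mono) auto
    moreover have "\<epsilon> l / (real k + 1) \<le> \<epsilon> k"
      unfolding \<epsilon>_def[of k] by (intro divide_right_mono) (auto simp: \<epsilon>_def)
    ultimately show ?thesis by simp
  qed
  have "weight_conditions A \<epsilon>"
    unfolding weight_conditions_def
  proof (intro conjI allI impI ballI)
    show "\<epsilon> k > 0" for k by (rule \<epsilon>_pos)
    show "\<epsilon> \<longlonglongrightarrow> 0" by (rule \<epsilon>_lim)
  next
    fix l k n m s i i'
    assume "n \<in> A l" "m \<in> A k" "s \<in> {1..N}" "i \<in> {1..k}" "i' > l" "(f s ^^ m) i = (f s ^^ n) i'"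
    then show "norm (W s i' n) / norm (W s i m) \<le> min (\<epsilon> l) (\<epsilon> k)"
      by (intro min.boundedI; use ratio in blast)
  next
    fix l i k n s t m i'
    assume "n \<in> A k" "m \<in> A l - {n}" "s \<in> {1..N}" "t \<in> {1..N}" "i \<in> {1..l}" "i' > k"
      "(f t ^^ m) i = (f s ^^ n) i'"
    then show "norm (W s i' n) / norm (W t i m) \<le> \<epsilon> l" using ratio by blast
  next
    fix k l i n s t m i'
    assume "n \<in> A l" "m \<in> A k" "s \<in> {1..N}" "t \<in> {1..N}" "i \<in> {1..k}" "i' > l"
      "(f t ^^ m) i = (f s ^^ n) i'"
    then show "norm (W s i' n) / norm (W t i m) \<le> \<epsilon> l" using ratio by blast
  next
    fix k j s :: nat assume kj: "k \<ge> 1" "j \<in> {1..k}" "s \<in> {1..N}"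
    show "filterlim (\<lambda>n. norm (W s j n)) at_top (inf sequentially (principal (A k)))"
      unfolding filterlim_at_top eventually_inf_principal
    proof
      fix B :: real
      have ge: "(f s ^^ n) j \<ge> n" for n
        using is_pseudo_shift_funpow_ge[OF shift[OF kj(3)], of j n] kj(2) by simp
      have "(\<lambda>n. X ((f s ^^ n) j)) \<longlonglongrightarrow> 0"
      proof (rule filterlim_compose[of X])
        show "X \<longlonglongrightarrow> 0" using x by (simp add: c0_def X_def)
        show "filterlim (\<lambda>n. (f s ^^ n) j) at_top sequentially"
          using ge by (intro filterlim_at_top_mono[OF filterlim_ident] always_eventually) blast
      qed
      then have "\<forall>\<^sub>F n in sequentially. norm (X ((f s ^^ n) j)) < 1 / (\<bar>B\<bar> + 1)"
        by (intro order_tendstoD(2)[OF tendsto_norm_zero]) auto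
      then show "\<forall>\<^sub>F n in sequentially. n \<in> A k \<longrightarrow> B \<le> norm (W s j n)"
      proof eventually_elim
        case (elim n)
        show ?case
        proof
          assume n: "n \<in> A k"
          let ?b = "norm (W s j n)" and ?x = "norm (X ((f s ^^ n) j))"
          have "1 \<le> ?b * ?x" using low[OF n kj(3,2)] by (simp add: norm_mult)
          also have "\<dots> \<le> ?b * (1 / (\<bar>B\<bar> + 1))" using elim by (intro mult_left_mono) auto
          finally have "\<bar>B\<bar> + 1 \<le> ?b" by (simp add: field_simps)
          then show "B \<le> ?b" by simp
        qed
      qed
    qed
  next
    fix l and a :: "nat \<Rightarrow> nat \<Rightarrow> 'k" and \<delta> :: real
    assume l: "1 \<le> l" and \<delta>: "0 < \<delta>" and a: "\<forall>s\<in>{1..N}. \<forall>j\<in>{1..l}. a s j \<noteq> 0"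
    \<comment> \<open>The index \<open>Suc l\<close> stands for all indices beyond \<open>l\<close>, where \<open>a'\<close> vanishes.\<close>
    define a' where "a' s j = (if j \<in> {1..l} then a s j else 0)" for s j
    have "\<forall>\<^sub>F \<eta> in at_right (0::real). \<forall>s\<in>{1..N}. \<forall>t\<in>{1..N}. \<forall>i\<in>{1..l}. \<forall>i'\<in>{1..Suc l}.
        \<forall>u v. norm (u - a' s i') \<le> \<eta> \<longrightarrow> norm (v - a' t i) \<le> \<eta> \<longrightarrow>
          norm (u / v - a' s i' / a' t i) \<le> \<delta>"
      using a \<delta> by (intro eventually_ball_finite ballI eventually_quotient_close) (auto simp: a'_def)
    moreover have "\<forall>\<^sub>F \<eta> in at_right (0::real). \<eta> > 0" by (rule eventually_at_right_less)
    ultimately have "\<forall>\<^sub>F \<eta> in at_right (0::real). \<eta> > 0 \<and>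
        (\<forall>s\<in>{1..N}. \<forall>t\<in>{1..N}. \<forall>i\<in>{1..l}. \<forall>i'\<in>{1..Suc l}.
        \<forall>u v. norm (u - a' s i') \<le> \<eta> \<longrightarrow> norm (v - a' t i) \<le> \<eta> \<longrightarrow>
          norm (u / v - a' s i' / a' t i) \<le> \<delta>)" by eventually_elim blast
    then obtain \<eta> where \<eta>: "\<eta> > 0" and quot: "\<And>s t i i' u v.
        \<lbrakk>s \<in> {1..N}; t \<in> {1..N}; i \<in> {1..l}; i' \<in> {1..Suc l}; norm (u - a' s i') \<le> \<eta>;
          norm (v - a' t i) \<le> \<eta>\<rbrakk> \<Longrightarrow> norm (u / v - a' s i' / a' t i) \<le> \<delta>"
      using eventually_happens'[OF trivial_limit_at_right_real] by blast
    have "\<forall>\<^sub>F L in sequentially. \<epsilon> L < \<eta> / 2"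
      using \<epsilon>_lim \<eta> by (intro order_tendstoD(2)[OF \<epsilon>_lim]) auto
    then obtain P where P: "\<And>L. L \<ge> P \<Longrightarrow> \<epsilon> L < \<eta> / 2" unfolding eventually_sequentially by blast
    have "a' s \<longlonglongrightarrow> 0" for s
      by (rule tendsto_eventually, use eventually_gt_at_top[of l] in eventually_elim)
         (simp add: a'_def)
    then obtain L where L: "L \<ge> max l P"
      "\<And>s j. \<lbrakk>s \<in> {1..N}; j \<ge> 1\<rbrakk> \<Longrightarrow> norm (z L s j - a' s j) \<le> \<eta> / 2"
      using z(2)[of a' "\<eta> / 2" "max l P"] \<eta> by auto
    have near: "norm (W s j n * X ((f s ^^ n) j) / of_real (c L) - a' s j) \<le> \<eta>"
      if "n \<in> A L" "s \<in> {1..N}" "j \<ge> 1" for n s j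
    proof -
      \<comment> \<open>Scaling back by \<open>c L \<ge> 1\<close> turns closeness to \<open>y L\<close> into closeness to \<open>z L\<close>.\<close>
      let ?u = "W s j n * X ((f s ^^ n) j)"
      have cL: "c L > 0" using c(1)[of L] by simp
      have "norm (?u / of_real (c L) - y L s j / of_real (c L)) = norm (?u - y L s j) / c L"
        using cL by (simp add: diff_divide_distrib[symmetric] norm_divide)
      also have "\<dots> \<le> norm (?u - y L s j)"
        using c(1)[of L] mult_left_mono[of 1 "c L" "norm (?u - y L s j)"]
        by (simp add: pos_divide_le_eq)
      also have "\<dots> \<le> \<eta> / 2" using close[OF that] P[of L] L(1) by simp
      finally have 1: "norm (?u / of_real (c L) - y L s j / of_real (c L)) \<le> \<eta> / 2" .
      have 2: "norm (y L s j / of_real (c L) - a' s j) \<le> \<eta> / 2"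
      proof (cases "j \<le> L")
        case True
        then show ?thesis using that cL L(2)[of s j] by (simp add: y_def)
      next
        case False
        then show ?thesis using L(1) \<eta> by (simp add: y_def a'_def)
      qed
      show ?thesis using norm_triangle_le[OF add_mono[OF 1 2]] by simp
    qed
    have cancel: "W s i' n / W t i n =
        (W s i' n * X ((f s ^^ n) i') / of_real (c L)) / (W t i n * X ((f t ^^ n) i) / of_real (c L))"
      if "n \<in> A L" "t \<in> {1..N}" "i \<in> {1..l}" "(f t ^^ n) i = (f s ^^ n) i'" for n s t i i'
    proof -
      have "W t i n * X ((f t ^^ n) i) \<noteq> 0" using low[of n L t i] that L(1) by auto
      then have "X ((f s ^^ n) i') \<noteq> 0" using that(4) by auto
      moreover have "c L \<noteq> 0" using c(1)[of L] by linarith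
      ultimately show ?thesis using that(4) by simp
    qed
    show "\<exists>L\<ge>l. \<forall>s\<in>{1..N}. \<forall>t\<in>{1..N}. s \<noteq> t \<longrightarrow> (\<forall>n\<in>A L. \<forall>i\<in>{1..l}.
          (\<forall>i'\<in>{1..l}. (f t ^^ n) i = (f s ^^ n) i' \<longrightarrow>
             norm (W s i' n / W t i n - a s i' / a t i) \<le> \<delta>) \<and>
          (\<forall>i'>l. (f t ^^ n) i = (f s ^^ n) i' \<longrightarrow>
             norm (W s i' n) / norm (W t i n) \<le> \<delta>))"
    proof (intro exI conjI ballI impI allI)
      show "l \<le> L" using L(1) by simp
    next
      fix s t n i i'
      assume st: "s \<in> {1..N}" "t \<in> {1..N}" and n: "n \<in> A L" and i: "i \<in> {1..l}"
        and i': "i' \<in> {1..l}" and eq: "(f t ^^ n) i = (f s ^^ n) i'"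
      show "norm (W s i' n / W t i n - a s i' / a t i) \<le> \<delta>"
        using quot[OF st i _ near[OF n st(1)] near[OF n st(2)], of i'] i i'
        by (simp add: cancel[OF n st(2) i eq] a'_def)
    next
      fix s t n i i'
      assume st: "s \<in> {1..N}" "t \<in> {1..N}" and n: "n \<in> A L" and i: "i \<in> {1..l}"
        and i': "i' > l" and eq: "(f t ^^ n) i = (f s ^^ n) i'"
      have "norm (W s i' n * X ((f s ^^ n) i') / of_real (c L) - a' s (Suc l)) \<le> \<eta>"
        using near[OF n st(1), of i'] i' by (simp add: a'_def)
      from quot[OF st i _ this near[OF n st(2)]]
      have "norm (W s i' n / W t i n) \<le> \<delta>"
        using i unfolding cancel[OF n st(2) i eq] by (simp add: a'_def)
      then show "norm (W s i' n) / norm (W t i n) \<le> \<delta>" by (simp add: norm_divide)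
    qed
  qed
  then show ?thesis using A_fam by blast
qed


section \<open>From the weight conditions to a disjoint hypercyclic vector\<close>

lemma weight_conditionsD:
  assumes "weight_conditions A \<epsilon>"
  shows "\<And>k. k \<ge> 1 \<Longrightarrow> \<epsilon> k > 0" "\<epsilon> \<longlonglongrightarrow> 0"
    "\<And>k j s. \<lbrakk>j \<in> {1..k}; s \<in> {1..N}\<rbrakk> \<Longrightarrow>
       filterlim (\<lambda>n. norm (W s j n)) at_top (inf sequentially (principal (A k)))"
    "\<And>l k n m s i i'. \<lbrakk>l \<ge> 1; n \<in> A l; m \<in> A k; s \<in> {1..N}; i \<in> {1..k}; i' > l;
       (f s ^^ m) i = (f s ^^ n) i'\<rbrakk> \<Longrightarrow> norm (W s i' n) / norm (W s i m) \<le> min (\<epsilon> l) (\<epsilon> k)"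
    "\<And>l k n m s t i i'. \<lbrakk>k \<ge> 1; n \<in> A k; m \<in> A l; m \<noteq> n; s \<in> {1..N}; t \<in> {1..N}; s \<noteq> t;
       i \<in> {1..l}; i' > k; (f t ^^ m) i = (f s ^^ n) i'\<rbrakk> \<Longrightarrow>
       norm (W s i' n) / norm (W t i m) \<le> \<epsilon> l"
    "\<And>l k n m s t i i'. \<lbrakk>k < l; n \<in> A l; m \<in> A k; s \<in> {1..N}; t \<in> {1..N}; s \<noteq> t;
       i \<in> {1..k}; i' > l; (f t ^^ m) i = (f s ^^ n) i'\<rbrakk> \<Longrightarrow>
       norm (W s i' n) / norm (W t i m) \<le> \<epsilon> l"
    "\<And>l a \<delta>. \<lbrakk>l \<ge> 1; \<And>s j. \<lbrakk>s \<in> {1..N}; j \<in> {1..l}\<rbrakk> \<Longrightarrow> a s j \<noteq> 0; \<delta> > 0\<rbrakk> \<Longrightarrow>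
       \<exists>L\<ge>l. \<forall>s\<in>{1..N}. \<forall>t\<in>{1..N}. s \<noteq> t \<longrightarrow> (\<forall>n\<in>A L. \<forall>i\<in>{1..l}.
          (\<forall>i'\<in>{1..l}. (f t ^^ n) i = (f s ^^ n) i' \<longrightarrow>
             norm (W s i' n / W t i n - a s i' / a t i) \<le> \<delta>) \<and>
          (\<forall>i'>l. (f t ^^ n) i = (f s ^^ n) i' \<longrightarrow>
             norm (W s i' n) / norm (W t i n) \<le> \<delta>))"
proof -
  note H = assms[unfolded weight_conditions_def]
  note c3 = H[THEN conjunct2, THEN conjunct2, THEN conjunct1, rule_format]
  note c4 = H[THEN conjunct2, THEN conjunct2, THEN conjunct2, THEN conjunct1, rule_format]
  note c5 = H[THEN conjunct2, THEN conjunct2, THEN conjunct2, THEN conjunct2, THEN conjunct1,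
      rule_format]
  note c6 = H[THEN conjunct2, THEN conjunct2, THEN conjunct2, THEN conjunct2, THEN conjunct2,
      THEN conjunct1, rule_format]
  note c7 = H[THEN conjunct2, THEN conjunct2, THEN conjunct2, THEN conjunct2, THEN conjunct2,
      THEN conjunct2, THEN spec, THEN mp, THEN spec, THEN spec, THEN mp, THEN mp]
  show "\<epsilon> k > 0" if "k \<ge> 1" for k using H[THEN conjunct1] that by simp
  show "\<epsilon> \<longlonglongrightarrow> 0" by (rule H[THEN conjunct2, THEN conjunct1])
  show "filterlim (\<lambda>n. norm (W s j n)) at_top (inf sequentially (principal (A k)))"
    if "j \<in> {1..k}" "s \<in> {1..N}" for k j s
    by (rule c3) (use that in auto)
  show "norm (W s i' n) / norm (W s i m) \<le> min (\<epsilon> l) (\<epsilon> k)"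
    if "l \<ge> 1" "n \<in> A l" "m \<in> A k" "s \<in> {1..N}" "i \<in> {1..k}" "i' > l"
       "(f s ^^ m) i = (f s ^^ n) i'" for l k n m s i i'
    by (rule c4) (use that in auto)
  show "norm (W s i' n) / norm (W t i m) \<le> \<epsilon> l"
    if "k \<ge> 1" "n \<in> A k" "m \<in> A l" "m \<noteq> n" "s \<in> {1..N}" "t \<in> {1..N}" "s \<noteq> t"
       "i \<in> {1..l}" "i' > k" "(f t ^^ m) i = (f s ^^ n) i'" for l k n m s t i i'
    by (rule c5[where k = k]) (use that in auto)
  show "norm (W s i' n) / norm (W t i m) \<le> \<epsilon> l"
    if "k < l" "n \<in> A l" "m \<in> A k" "s \<in> {1..N}" "t \<in> {1..N}" "s \<noteq> t"
       "i \<in> {1..k}" "i' > l" "(f t ^^ m) i = (f s ^^ n) i'" for l k n m s t i i'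
    by (rule c6[where k = k]) (use that in auto)
  show "\<exists>L\<ge>l. \<forall>s\<in>{1..N}. \<forall>t\<in>{1..N}. s \<noteq> t \<longrightarrow> (\<forall>n\<in>A L. \<forall>i\<in>{1..l}.
          (\<forall>i'\<in>{1..l}. (f t ^^ n) i = (f s ^^ n) i' \<longrightarrow>
             norm (W s i' n / W t i n - a s i' / a t i) \<le> \<delta>) \<and>
          (\<forall>i'>l. (f t ^^ n) i = (f s ^^ n) i' \<longrightarrow>
             norm (W s i' n) / norm (W t i n) \<le> \<delta>))"
    if "l \<ge> 1" "\<And>s j. \<lbrakk>s \<in> {1..N}; j \<in> {1..l}\<rbrakk> \<Longrightarrow> a s j \<noteq> 0" "\<delta> > 0" for l a \<delta>
    by (rule c7) (use that in blast)+
qed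

text \<open>
  A weight product is an initial part of all later ones with the same starting index, and along
  \<open>A j\<close> these become large, so no factor can vanish.
\<close>

lemma weight_prod_nonzero:
  assumes "weight_conditions A \<epsilon>" "\<And>k. k \<ge> 1 \<Longrightarrow> infinite (A k)" "s \<in> {1..N}" "j \<ge> 1"
  shows "W s j n \<noteq> 0"
proof -
  have "\<forall>\<^sub>F m in sequentially. m \<in> A j \<longrightarrow> 1 \<le> norm (W s j m)"
    using weight_conditionsD(3)[OF assms(1), of j j s] assms(3,4)
    unfolding filterlim_at_top eventually_inf_principal by auto
  then obtain n0 where n0: "\<And>m. m \<ge> n0 \<Longrightarrow> m \<in> A j \<Longrightarrow> 1 \<le> norm (W s j m)"
    unfolding eventually_sequentially by blast
  obtain m where m: "m > max n n0" "m \<in> A j"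
    using assms(2)[OF assms(4)] unfolding infinite_nat_iff_unbounded by blast
  then have "W s j m \<noteq> 0" using n0[of m] by auto
  then show ?thesis by (rule weight_prod_nonzero_prefix) (use m in simp)
qed

text \<open>
  Stage \<open>p\<close> serves the target \<open>z p\<close>, truncated at \<open>l p\<close>, at times taken from \<open>A (L p)\<close>. The bound
  \<open>M p\<close> dominates all targets up to stage \<open>p\<close>. Since \<open>l p\<close> is chosen after \<open>M p\<close> and \<open>L p \<ge> l p\<close>,
  the error \<open>\<epsilon> (L p)\<close> beats the size of every target up to stage \<open>p\<close>. Hence the interaction of two
  stages is controlled by the error of the later one, whatever the size of the targets.
\<close>

lemma stages_exist:
  assumes wc: "weight_conditions A \<epsilon>"
    and z: "\<And>p s j. s \<in> {1..N} \<Longrightarrow> z p s j \<noteq> 0" "\<And>p s. z p s \<longlonglongrightarrow> 0"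
  obtains M :: "nat \<Rightarrow> real" and L l :: "nat \<Rightarrow> nat"
  where "mono M" "\<And>p. M p \<ge> 1" "\<And>p s j. s \<in> {1..N} \<Longrightarrow> norm (z p s j) \<le> M p"
    "strict_mono L" "\<And>p. 1 \<le> l p" "\<And>p. l p \<le> L p"
    "\<And>p s j. \<lbrakk>s \<in> {1..N}; j > l p\<rbrakk> \<Longrightarrow> norm (z p s j) \<le> 1 / (real p + 1)"
    "\<And>p k. k \<ge> l p \<Longrightarrow> \<epsilon> k * M p \<le> 1 / (real p + 1)" "\<And>p k. k \<ge> l p \<Longrightarrow> \<epsilon> k < 1"
    "\<And>p s t n i i'. \<lbrakk>s \<in> {1..N}; t \<in> {1..N}; s \<noteq> t; n \<in> A (L p); i \<in> {1..l p}; i' \<in> {1..l p};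
       (f t ^^ n) i = (f s ^^ n) i'\<rbrakk> \<Longrightarrow>
       norm (W s i' n / W t i n - z p s i' / z p t i) * M p \<le> 1 / (real p + 1)"
    "\<And>p s t n i i'. \<lbrakk>s \<in> {1..N}; t \<in> {1..N}; s \<noteq> t; n \<in> A (L p); i \<in> {1..l p}; i' > l p;
       (f t ^^ n) i = (f s ^^ n) i'\<rbrakk> \<Longrightarrow>
       norm (W s i' n) / norm (W t i n) * M p \<le> 1 / (real p + 1)"
proof -
  have "\<exists>K\<ge>0. \<forall>s\<in>{1..N}. \<forall>j. norm (z p s j) \<le> K" for p
  proof -
    have "bounded (\<Union>s\<in>{1..N}. range (z p s))"
      using z(2) convergent_imp_bounded by (intro bounded_UN) auto
    then obtain K where "\<forall>v\<in>(\<Union>s\<in>{1..N}. range (z p s)). norm v \<le> K"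
      by (auto simp: bounded_iff)
    then have "\<forall>s\<in>{1..N}. \<forall>j. norm (z p s j) \<le> max K 0" by (auto simp: le_max_iff_disj)
    then show ?thesis by (intro exI[of _ "max K 0"]) auto
  qed
  then obtain K where K: "\<And>p. K p \<ge> 0" "\<And>p s j. s \<in> {1..N} \<Longrightarrow> norm (z p s j) \<le> K p"
    by metis
  define M where "M p = 1 + (\<Sum>q\<le>p. K q)" for p
  have M_mono: "mono M"
    by (intro incseq_SucI) (simp add: M_def K)
  have M1: "M p \<ge> 1" for p by (simp add: M_def sum_nonneg K)
  have M_bound: "norm (z p s j) \<le> M p" if "s \<in> {1..N}" for p s j
  proof -
    have "K p \<le> (\<Sum>q\<le>p. K q)" by (intro member_le_sum) (auto simp: K)
    then show ?thesis using K(2)[OF that, of p j] by (simp add: M_def)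
  qed
  define \<eta> where "\<eta> p = 1 / ((real p + 1) * M p)" for p :: nat
  have \<eta>_pos: "\<eta> p > 0" for p using M1[of p] by (simp add: \<eta>_def)
  have \<eta>_M: "u * M p \<le> 1 / (real p + 1)" if "u \<le> \<eta> p" for u p
  proof -
    have "u * M p \<le> \<eta> p * M p" using that M1[of p] by (intro mult_right_mono) auto
    also have "\<dots> = 1 / (real p + 1)" using M1[of p] by (simp add: \<eta>_def)
    finally show ?thesis .
  qed
  define P where "P p q \<longleftrightarrow> (case q of (l, L) \<Rightarrow> 1 \<le> l \<and> l \<le> L \<and>
     (\<forall>s\<in>{1..N}. \<forall>j>l. norm (z p s j) \<le> 1 / (real p + 1)) \<and>
     (\<forall>k\<ge>l. \<epsilon> k \<le> \<eta> p \<and> \<epsilon> k < 1) \<and>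
     (\<forall>s\<in>{1..N}. \<forall>t\<in>{1..N}. s \<noteq> t \<longrightarrow> (\<forall>n\<in>A L. \<forall>i\<in>{1..l}.
          (\<forall>i'\<in>{1..l}. (f t ^^ n) i = (f s ^^ n) i' \<longrightarrow>
             norm (W s i' n / W t i n - z p s i' / z p t i) \<le> \<eta> p) \<and>
          (\<forall>i'>l. (f t ^^ n) i = (f s ^^ n) i' \<longrightarrow>
             norm (W s i' n) / norm (W t i n) \<le> \<eta> p))))" for p q
  have step: "\<exists>l L. P p (l, L) \<and> l > Q" for p Q
  proof -
    have "\<forall>\<^sub>F k in sequentially. \<forall>s\<in>{1..N}. norm (z p s k) < 1 / (real p + 1)"
      using z(2) by (intro eventually_ball_finite ballI order_tendstoD(2)[OF tendsto_norm_zero]) auto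
    moreover have "\<forall>\<^sub>F k in sequentially. \<epsilon> k < \<eta> p"
      using \<eta>_pos by (rule order_tendstoD(2)[OF weight_conditionsD(2)[OF wc]])
    moreover have "\<forall>\<^sub>F k in sequentially. \<epsilon> k < 1"
      by (rule order_tendstoD(2)[OF weight_conditionsD(2)[OF wc]]) simp
    ultimately have "\<forall>\<^sub>F k in sequentially. (\<forall>s\<in>{1..N}. norm (z p s k) < 1 / (real p + 1)) \<and>
        \<epsilon> k < \<eta> p \<and> \<epsilon> k < 1" by eventually_elim simp
    then obtain l0 where l0: "\<And>k. k \<ge> l0 \<Longrightarrow>
        (\<forall>s\<in>{1..N}. norm (z p s k) < 1 / (real p + 1)) \<and> \<epsilon> k < \<eta> p \<and> \<epsilon> k < 1"
      unfolding eventually_sequentially by blast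
    define l where "l = max l0 (Suc Q)"
    have l: "1 \<le> l" "l0 \<le> l" "Q < l" by (auto simp: l_def)
    from weight_conditionsD(7)[OF wc l(1), of "z p", OF z(1) \<eta>_pos]
    obtain L where "L \<ge> l" "\<forall>s\<in>{1..N}. \<forall>t\<in>{1..N}. s \<noteq> t \<longrightarrow> (\<forall>n\<in>A L. \<forall>i\<in>{1..l}.
          (\<forall>i'\<in>{1..l}. (f t ^^ n) i = (f s ^^ n) i' \<longrightarrow>
             norm (W s i' n / W t i n - z p s i' / z p t i) \<le> \<eta> p) \<and>
          (\<forall>i'>l. (f t ^^ n) i = (f s ^^ n) i' \<longrightarrow>
             norm (W s i' n) / norm (W t i n) \<le> \<eta> p))" by blast
    moreover have "\<forall>s\<in>{1..N}. \<forall>j>l. norm (z p s j) \<le> 1 / (real p + 1)"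
      using l0 l(2) by (auto intro: less_imp_le)
    moreover have "\<forall>k\<ge>l. \<epsilon> k \<le> \<eta> p \<and> \<epsilon> k < 1"
    proof (intro allI impI)
      fix k assume "k \<ge> l"
      then have "k \<ge> l0" using l(2) by simp
      from l0[OF this] show "\<epsilon> k \<le> \<eta> p \<and> \<epsilon> k < 1" by simp
    qed
    ultimately have "P p (l, L)" using l(1) unfolding P_def by simp
    with l(3) show ?thesis by blast
  qed
  have "\<exists>h. \<forall>p. P p (h p) \<and> fst (h (Suc p)) > snd (h p)"
    by (rule dependent_nat_choice) (use step in \<open>metis fst_conv\<close>)+
  then obtain h where h: "\<And>p. P p (h p)" "\<And>p. fst (h (Suc p)) > snd (h p)" by blast
  define l where "l p = fst (h p)" for p
  define L where "L p = snd (h p)" for p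
  have PL: "P p (l p, L p)" for p using h(1)[of p] by (simp add: l_def L_def)
  note PL' = PL[unfolded P_def prod.case]
  have lL: "l p \<le> L p" for p using PL'[of p] by blast
  show thesis
  proof (rule that[OF M_mono M1 M_bound _ _ lL])
    show "strict_mono L"
      unfolding strict_mono_Suc_iff
      using h(2) lL by (metis L_def l_def less_le_trans)
    show "1 \<le> l p" for p using PL'[of p] by blast
    show "norm (z p s j) \<le> 1 / (real p + 1)" if "s \<in> {1..N}" "j > l p" for p s j
      using PL'[of p] that by blast
    show "\<epsilon> k * M p \<le> 1 / (real p + 1)" if "k \<ge> l p" for p k
      using PL'[of p] that by (intro \<eta>_M) blast
    show "\<epsilon> k < 1" if "k \<ge> l p" for p k using PL'[of p] that by blast
    show "norm (W s i' n / W t i n - z p s i' / z p t i) * M p \<le> 1 / (real p + 1)"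
      if "s \<in> {1..N}" "t \<in> {1..N}" "s \<noteq> t" "n \<in> A (L p)" "i \<in> {1..l p}" "i' \<in> {1..l p}"
       "(f t ^^ n) i = (f s ^^ n) i'" for p s t n i i'
      using PL'[of p] that by (intro \<eta>_M) blast
    show "norm (W s i' n) / norm (W t i n) * M p \<le> 1 / (real p + 1)"
      if "s \<in> {1..N}" "t \<in> {1..N}" "s \<noteq> t" "n \<in> A (L p)" "i \<in> {1..l p}" "i' > l p"
       "(f t ^^ n) i = (f s ^^ n) i'" for p s t n i i'
      using PL'[of p] that by (intro \<eta>_M) blast
  qed
qed

text \<open>
  Where several blocks meet at a coordinate, an arbitrary one of them is written into \<open>x\<close>. The
  lower bound on the weights makes the coordinates small in late stages, and within one stage they
  tend to zero because the weights tend to infinity.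
\<close>

lemma block_vector_exists:
  assumes M: "\<And>p. M p \<ge> 1" "\<And>p s j. s \<in> {1..N} \<Longrightarrow> norm (z p s j) \<le> M p"
    and big: "\<And>p n s j. \<lbrakk>n \<in> H p; s \<in> {1..N}; j \<in> {1..l p}\<rbrakk> \<Longrightarrow>
      (real p + 1) * M p \<le> norm (W s j n)"
    and lim: "\<And>p s j. \<lbrakk>s \<in> {1..N}; j \<in> {1..l p}\<rbrakk> \<Longrightarrow>
      filterlim (\<lambda>n. norm (W s j n)) at_top (inf sequentially (principal (H p)))"
  obtains x where "x \<in> c0"
    "\<And>i. apply_bcontfun x i \<noteq> 0 \<Longrightarrow> \<exists>p n s j. n \<in> H p \<and> s \<in> {1..N} \<and> j \<in> {1..l p} \<and>
       i = (f s ^^ n) j \<and> apply_bcontfun x i = z p s j / W s j n"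
    "\<And>p n s j. \<lbrakk>n \<in> H p; s \<in> {1..N}; j \<in> {1..l p}; z p s j \<noteq> 0\<rbrakk> \<Longrightarrow>
       \<exists>q m t i. m \<in> H q \<and> t \<in> {1..N} \<and> i \<in> {1..l q} \<and> (f s ^^ n) j = (f t ^^ m) i \<and>
         apply_bcontfun x ((f s ^^ n) j) = z q t i / W t i m"
proof -
  define block where "block i v \<longleftrightarrow> (\<exists>p n s j. n \<in> H p \<and> s \<in> {1..N} \<and> j \<in> {1..l p} \<and>
       i = (f s ^^ n) j \<and> v = z p s j / W s j n)" for i v
  define X where "X i = (if \<exists>v. block i v then SOME v. block i v else 0)" for i
  have X_block: "block i (X i)" if "block i v" for i v
  proof -
    have "X i = (SOME v. block i v)" using that unfolding X_def by (intro if_P exI)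
    then show ?thesis using someI[of "block i", OF that] by simp
  qed
  have X_block': "block i (X i)" if "X i \<noteq> 0" for i
  proof -
    have "\<exists>v. block i v" using that by (metis X_def)
    then show ?thesis using X_block by blast
  qed
  have "\<forall>\<^sub>F i in sequentially. norm (X i) < \<eta>" if \<eta>: "\<eta> > 0" for \<eta> :: real
  proof -
    obtain p0 :: nat where p0: "1 / \<eta> < real p0" using reals_Archimedean2 by blast
    have fin: "finite {n \<in> H p. norm (W s j n) \<le> M p / \<eta>}"
      if "s \<in> {1..N}" "j \<in> {1..l p}" for p s j
    proof -
      have "\<forall>\<^sub>F n in sequentially. n \<in> H p \<longrightarrow> M p / \<eta> < norm (W s j n)"
        using lim[OF that] unfolding filterlim_at_top_dense eventually_inf_principal by blast
      then obtain n0 where "\<And>n. n \<ge> n0 \<Longrightarrow> n \<in> H p \<Longrightarrow> M p / \<eta> < norm (W s j n)"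
        unfolding eventually_sequentially by blast
      then have "{n \<in> H p. norm (W s j n) \<le> M p / \<eta>} \<subseteq> {..<n0}" by (force simp: not_le[symmetric])
      then show ?thesis by (rule finite_subset) simp
    qed
    \<comment> \<open>A large entry comes from a stage \<open>p \<le> p0\<close> and a time with small weight: finitely many cases.\<close>
    have "{i. \<eta> \<le> norm (X i)} \<subseteq> (\<Union>p\<in>{..p0}. \<Union>s\<in>{1..N}. \<Union>j\<in>{1..l p}.
        (\<lambda>n. (f s ^^ n) j) ` {n \<in> H p. norm (W s j n) \<le> M p / \<eta>})"
    proof
      fix i assume "i \<in> {i. \<eta> \<le> norm (X i)}"
      then have i: "\<eta> \<le> norm (X i)" by simp
      then have "X i \<noteq> 0" using \<eta> by auto
      from X_block'[OF this] obtain p n s j where b: "n \<in> H p" "s \<in> {1..N}" "j \<in> {1..l p}"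
        "i = (f s ^^ n) j" "X i = z p s j / W s j n" unfolding block_def by blast
      have large: "(real p + 1) * M p \<le> norm (W s j n)" by (rule big[OF b(1-3)])
      have "0 < (real p + 1) * M p" using M(1)[of p] by simp
      with large have pos: "0 < norm (W s j n)" by linarith
      have "\<eta> \<le> norm (z p s j) / norm (W s j n)" using i b(5) by (simp add: norm_divide)
      then have "\<eta> * norm (W s j n) \<le> norm (z p s j)" using pos by (simp add: pos_le_divide_eq)
      also have "\<dots> \<le> M p" by (rule M(2)[OF b(2)])
      finally have le: "\<eta> * norm (W s j n) \<le> M p" .
      then have W_le: "norm (W s j n) \<le> M p / \<eta>" using \<eta> by (simp add: pos_le_divide_eq mult.commute)
      have "\<eta> * ((real p + 1) * M p) \<le> \<eta> * norm (W s j n)"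
        using large \<eta> by (intro mult_left_mono) auto
      with le have "(\<eta> * (real p + 1)) * M p \<le> 1 * M p" by (simp add: mult.assoc)
      then have "\<eta> * (real p + 1) \<le> 1" 
        by (rule mult_right_le_imp_le) (use M(1)[of p] in linarith)
      then have "real p + 1 \<le> 1 / \<eta>" using \<eta> by (simp add: pos_le_divide_eq mult.commute)
      then have "p \<le> p0" using p0 by linarith
      with W_le b show "i \<in> (\<Union>p\<in>{..p0}. \<Union>s\<in>{1..N}. \<Union>j\<in>{1..l p}.
        (\<lambda>n. (f s ^^ n) j) ` {n \<in> H p. norm (W s j n) \<le> M p / \<eta>})" by blast
    qed
    then have "finite {i. \<eta> \<le> norm (X i)}"
      by (rule finite_subset) (intro finite_UN_I finite_imageI fin finite_atMost finite_atLeastAtMost)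
    then have "\<forall>\<^sub>F i in sequentially. i \<notin> {i. \<eta> \<le> norm (X i)}"
      unfolding cofinite_eq_sequentially[symmetric] eventually_cofinite by simp
    then show ?thesis by eventually_elim simp
  qed
  then have X_lim: "X \<longlonglongrightarrow> 0" unfolding tendsto_iff by (simp add: dist_norm)
  have apply_X: "apply_bcontfun (Bcontfun X) = X"
    by (rule Bcontfun_inverse[OF tendsto_0_mem_bcontfun[OF X_lim]])
  have "X 0 = 0"
  proof (rule ccontr)
    assume "X 0 \<noteq> 0"
    then obtain s n j where "s \<in> {1..N}" "j \<ge> 1" "0 = (f s ^^ n) j"
      using X_block'[of 0] unfolding block_def by auto
    then show False using is_pseudo_shift_funpow_ge[OF shift, of s j n] by simp
  qed
  show thesis
  proof
    show "Bcontfun X \<in> c0" using X_lim \<open>X 0 = 0\<close> by (simp add: c0_def apply_X)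
    show "\<exists>p n s j. n \<in> H p \<and> s \<in> {1..N} \<and> j \<in> {1..l p} \<and>
       i = (f s ^^ n) j \<and> apply_bcontfun (Bcontfun X) i = z p s j / W s j n"
      if "apply_bcontfun (Bcontfun X) i \<noteq> 0" for i
      using X_block'[of i] that unfolding block_def apply_X .
    show "\<exists>q m t i. m \<in> H q \<and> t \<in> {1..N} \<and> i \<in> {1..l q} \<and> (f s ^^ n) j = (f t ^^ m) i \<and>
         apply_bcontfun (Bcontfun X) ((f s ^^ n) j) = z q t i / W t i m"
      if "n \<in> H p" "s \<in> {1..N}" "j \<in> {1..l p}" "z p s j \<noteq> 0" for p n s j
    proof -
      have "block ((f s ^^ n) j) (z p s j / W s j n)" unfolding block_def using that by blast
      from X_block[OF this] show ?thesis unfolding block_def apply_X .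
    qed
  qed
qed

text \<open>
  At a time of stage \<open>p\<close>, the blocks of the same time reproduce the target by the last weight
  condition. A block of a different time, from stage \<open>q\<close>, can only meet coordinates beyond \<open>L p\<close>
  because of weak partition regularity, and there it contributes at most \<open>\<epsilon> (L r) * M r\<close> with
  \<open>r = max p q\<close>, whichever of the first three weight conditions applies.
\<close>

lemma disjoint_hypercyclic_of_weight_conditions:
  assumes N: "N \<ge> 1"
    and fam: "\<A> \<in> {A_inf, A_uBd, A_ud, A_ld}"
    and wpr: "weakly_partition_regular \<A> N f"
    and A_fam: "\<And>k. k \<ge> 1 \<Longrightarrow> A k \<in> \<A>"
    and wc: "weight_conditions A \<epsilon>"
  shows "disjoint_hypercyclic \<A> c0 N T"
proof -
  note cond = weight_conditionsD[OF wc]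
  have W_nonzero: "W s j n \<noteq> 0" if "s \<in> {1..N}" "j \<ge> 1" for s j n
    using weight_prod_nonzero[OF wc density_family_infinite[OF fam A_fam] that] .
  obtain z :: "nat \<Rightarrow> nat \<Rightarrow> nat \<Rightarrow> 'k" where z_nonzero: "\<And>p s j. s \<in> {1..N} \<Longrightarrow> z p s j \<noteq> 0"
    and z_lim: "\<And>p s. z p s \<longlonglongrightarrow> 0"
    and z_dense: "\<And>a \<eta> P. \<lbrakk>\<And>s. s \<in> {1..N} \<Longrightarrow> a s \<longlonglongrightarrow> 0; \<eta> > 0\<rbrakk> \<Longrightarrow>
       \<exists>p\<ge>P. \<forall>s\<in>{1..N}. \<forall>j\<ge>1. norm (z p s j - a s j) \<le> \<eta>"
    by (rule universal_target_arrays[of N]) blast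
  obtain M l L where
    M_mono: "mono M" and M1: "\<And>p. M p \<ge> 1"
    and M_bound: "\<And>p s j. s \<in> {1..N} \<Longrightarrow> norm (z p s j) \<le> M p"
    and L_mono: "strict_mono L" and l1: "\<And>p. 1 \<le> l p" and lL: "\<And>p. l p \<le> L p"
    and tail: "\<And>p s j. \<lbrakk>s \<in> {1..N}; j > l p\<rbrakk> \<Longrightarrow> norm (z p s j) \<le> 1 / (real p + 1)"
    and \<epsilon>_M: "\<And>p k. k \<ge> l p \<Longrightarrow> \<epsilon> k * M p \<le> 1 / (real p + 1)"
    and \<epsilon>_1: "\<And>p k. k \<ge> l p \<Longrightarrow> \<epsilon> k < 1"
    and hit_low: "\<And>p s t n i i'. \<lbrakk>s \<in> {1..N}; t \<in> {1..N}; s \<noteq> t; n \<in> A (L p); i \<in> {1..l p};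
       i' \<in> {1..l p}; (f t ^^ n) i = (f s ^^ n) i'\<rbrakk> \<Longrightarrow>
       norm (W s i' n / W t i n - z p s i' / z p t i) * M p \<le> 1 / (real p + 1)"
    and hit_high: "\<And>p s t n i i'. \<lbrakk>s \<in> {1..N}; t \<in> {1..N}; s \<noteq> t; n \<in> A (L p); i \<in> {1..l p};
       i' > l p; (f t ^^ n) i = (f s ^^ n) i'\<rbrakk> \<Longrightarrow>
       norm (W s i' n) / norm (W t i n) * M p \<le> 1 / (real p + 1)"
    by (rule stages_exist[OF wc, of z]) (erule z_nonzero, rule z_lim, rule that)
  have L1: "L p \<ge> 1" for p using l1[of p] lL[of p] by simp

  \<comment> \<open>The threshold is stated in terms of \<open>k\<close>; at \<open>k = L p\<close> it dominates the one for stage \<open>p\<close>.\<close>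
  define B where "B k = {n \<in> A k. \<forall>s\<in>{1..N}. \<forall>j\<in>{1..k}. (real k + 1) * M k \<le> norm (W s j n)}" for k
  have B_fam: "B k \<in> \<A>" if "k \<ge> 1" for k
  proof (rule density_family_almost_superset[OF fam A_fam[OF that]])
    show "B k \<subseteq> {1..}" using density_family_subset[OF fam A_fam[OF that]] by (auto simp: B_def)
    have "\<forall>\<^sub>F n in sequentially. \<forall>s\<in>{1..N}. \<forall>j\<in>{1..k}. n \<in> A k \<longrightarrow> (real k + 1) * M k \<le> norm (W s j n)"
      using cond(3)[of _ k] unfolding filterlim_at_top eventually_inf_principal
      by (intro eventually_ball_finite ballI) simp_all
    then obtain n0 where "\<And>n. n \<ge> n0 \<Longrightarrow>
        \<forall>s\<in>{1..N}. \<forall>j\<in>{1..k}. n \<in> A k \<longrightarrow> (real k + 1) * M k \<le> norm (W s j n)"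
      unfolding eventually_sequentially by blast
    then have "A k - B k \<subseteq> {..<n0}" unfolding B_def by (force simp: not_le[symmetric])
    then show "finite (A k - B k)" by (rule finite_subset) simp
  qed
  have "\<exists>A'. (\<forall>l\<ge>1. A' l \<in> \<A> \<and> A' l \<subseteq> B l) \<and>
      (\<forall>l\<ge>1. \<forall>k\<ge>1. \<forall>m\<in>A' l. \<forall>n\<in>A' k. m \<noteq> n \<longrightarrow>
         (\<forall>s\<in>{1..N}. \<forall>t\<in>{1..N}. (f s ^^ m) ` {1..l} \<inter> (f t ^^ n) ` {1..k} = {}))"
    using wpr[unfolded weakly_partition_regular_def, THEN spec, of B] B_fam by simp
  then obtain A' where A': "\<forall>l\<ge>1. A' l \<in> \<A> \<and> A' l \<subseteq> B l"
    and separated: "\<forall>l\<ge>1. \<forall>k\<ge>1. \<forall>m\<in>A' l. \<forall>n\<in>A' k. m \<noteq> n \<longrightarrow>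
         (\<forall>s\<in>{1..N}. \<forall>t\<in>{1..N}. (f s ^^ m) ` {1..l} \<inter> (f t ^^ n) ` {1..k} = {})" by blast
  define H where "H p = A' (L p)" for p
  have H_fam: "H p \<in> \<A>" and H_B: "H p \<subseteq> B (L p)" for p using A' L1[of p] by (auto simp: H_def)
  have H_A: "n \<in> A (L p)" if "n \<in> H p" for n p using H_B[of p] that by (auto simp: B_def)

  have same_time: "n = m"
    if "n \<in> H p" "m \<in> H q" "s \<in> {1..N}" "t \<in> {1..N}" "i \<in> {1..L p}" "j \<in> {1..L q}"
      "(f s ^^ n) i = (f t ^^ m) j" for n m p q s t i j
  proof (rule ccontr)
    assume "n \<noteq> m"
    with separated L1 that have "(f s ^^ n) ` {1..L p} \<inter> (f t ^^ m) ` {1..L q} = {}"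
      by (simp add: H_def)
    moreover have "(f s ^^ n) i \<in> (f s ^^ n) ` {1..L p} \<inter> (f t ^^ m) ` {1..L q}"
      using imageI[OF that(5), of "f s ^^ n"] imageI[OF that(6), of "f t ^^ m"]
      unfolding that(7)[symmetric] by (rule IntI)
    ultimately show False by simp
  qed
  \<comment> \<open>A time shared by two stages would make the ratio in the first condition equal to one.\<close>
  have same_stage_aux: False if "p < q" "n \<in> H p" "n \<in> H q" for p q n
  proof -
    have lt: "L p < L q" using L_mono that(1) by (simp add: strict_mono_less)
    have 1: "1 \<in> {1..N}" using N by simp
    have "norm (W 1 (L q) n) / norm (W 1 (L q) n) \<le> min (\<epsilon> (L p)) (\<epsilon> (L q))"
      using cond(4)[OF L1 H_A[OF that(2)] H_A[OF that(3)] 1, of "L q" "L q"] lt L1[of q] by simp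
    then have "1 \<le> \<epsilon> (L p)" using W_nonzero[OF 1 L1] by simp
    with \<epsilon>_1[OF lL] show False by (metis not_le)
  qed
  have same_stage: "p = q" if "n \<in> H p" "n \<in> H q" for p q n
    using same_stage_aux that by (metis linorder_neqE_nat)

  obtain x where x: "x \<in> c0"
    and x_block: "\<And>i. apply_bcontfun x i \<noteq> 0 \<Longrightarrow>
       \<exists>p n s j. n \<in> H p \<and> s \<in> {1..N} \<and> j \<in> {1..l p} \<and>
         i = (f s ^^ n) j \<and> apply_bcontfun x i = z p s j / W s j n"
    and x_filled: "\<And>p n s j. \<lbrakk>n \<in> H p; s \<in> {1..N}; j \<in> {1..l p}; z p s j \<noteq> 0\<rbrakk> \<Longrightarrow>
       \<exists>q m t i. m \<in> H q \<and> t \<in> {1..N} \<and> i \<in> {1..l q} \<and> (f s ^^ n) j = (f t ^^ m) i \<and>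
         apply_bcontfun x ((f s ^^ n) j) = z q t i / W t i m"
  proof (rule block_vector_exists[of M z H l])
    show "(real p + 1) * M p \<le> norm (W s j n)"
      if "n \<in> H p" "s \<in> {1..N}" "j \<in> {1..l p}" for p n s j
    proof -
      have "p \<le> L p" by (rule strict_mono_imp_increasing[OF L_mono])
      then have "(real p + 1) * M p \<le> (real (L p) + 1) * M (L p)"
        using monoD[OF M_mono, of p "L p"] M1[of p] by (intro mult_mono) auto
      also have "\<dots> \<le> norm (W s j n)" using H_B[of p] that lL[of p] by (auto simp: B_def)
      finally show ?thesis .
    qed
    show "filterlim (\<lambda>n. norm (W s j n)) at_top (inf sequentially (principal (H p)))"
      if "s \<in> {1..N}" "j \<in> {1..l p}" for p s j
    proof (rule filterlim_mono[OF cond(3) order_refl])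
      show "j \<in> {1..L p}" using that(2) lL[of p] by simp
      show "inf sequentially (principal (H p)) \<le> inf sequentially (principal (A (L p)))"
        using H_A by (intro inf_mono) auto
    qed (fact that)
  qed (rule M1, erule M_bound, rule that)
  define X where "X = apply_bcontfun x"

  have estimate: "norm (W s j n * X ((f s ^^ n) j) - z p s j) \<le> 2 / (real p + 1)"
    if n: "n \<in> H p" and s: "s \<in> {1..N}" and j: "j \<ge> 1" for p n s j
  proof (cases "j \<le> l p")
    case True
    then have jl: "j \<in> {1..l p}" using j by simp
    obtain q m t i where b: "m \<in> H q" "t \<in> {1..N}" "i \<in> {1..l q}" "(f s ^^ n) j = (f t ^^ m) i"
      "X ((f s ^^ n) j) = z q t i / W t i m"
      using x_filled[OF n s jl z_nonzero[OF s]] unfolding X_def by blast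
    \<comment> \<open>The block found at this coordinate has the same time and stage, but maybe another shift.\<close>
    have "n = m" by (rule same_time[OF n b(1) s b(2) _ _ b(4)]) (use jl b(3) lL[of p] lL[of q] in auto)
    with same_stage[OF n] b(1) have m: "m = n" "q = p" by auto
    have "norm (W s j n * X ((f s ^^ n) j) - z p s j) \<le> 1 / (real p + 1)"
    proof (cases "s = t")
      case True
      then have "j = i"
        using inj_onD[OF is_pseudo_shift_inj_funpow[OF shift[OF s]], of n j i] b(3,4) j m by simp
      then show ?thesis using True b(5) m W_nonzero[OF s j, of n] by simp
    next
      case False
      have "W s j n * X ((f s ^^ n) j) - z p s j = (W s j n / W t i n - z p s j / z p t i) * z p t i"
        using z_nonzero[OF b(2), of p i] b(5) m by (simp add: left_diff_distrib)
      then have "norm (W s j n * X ((f s ^^ n) j) - z p s j)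
          \<le> norm (W s j n / W t i n - z p s j / z p t i) * M p"
        using M_bound[OF b(2), of p i] by (simp add: norm_mult mult_left_mono)
      also have "\<dots> \<le> 1 / (real p + 1)"
        using hit_low[OF s b(2) False H_A[OF n] _ jl] b(3,4) m by simp
      finally show ?thesis .
    qed
    also have "\<dots> \<le> 2 / (real p + 1)" by (intro divide_right_mono) auto
    finally show ?thesis .
  next
    case False
    have "norm (W s j n * X ((f s ^^ n) j)) \<le> 1 / (real p + 1)"
    proof (cases "X ((f s ^^ n) j) = 0")
      case nonzero: False
      obtain q m t i where b: "m \<in> H q" "t \<in> {1..N}" "i \<in> {1..l q}" "(f s ^^ n) j = (f t ^^ m) i"
        "X ((f s ^^ n) j) = z q t i / W t i m"
        using x_block[of "(f s ^^ n) j"] nonzero unfolding X_def by blast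
      let ?\<rho> = "norm (W s j n) / norm (W t i m)"
      have eq: "norm (W s j n * X ((f s ^^ n) j)) = ?\<rho> * norm (z q t i)"
        using b(5) by (simp add: norm_mult norm_divide)
      show ?thesis
      proof (cases "m = n")
        case True
        with same_stage[OF n] b(1) have q: "q = p" by auto
        have "s \<noteq> t"
        proof
          assume "s = t"
          then have "j = i"
            using inj_onD[OF is_pseudo_shift_inj_funpow[OF shift[OF s]], of n j i] b(3,4) j True
            by simp
          then show False using b(3) q False by simp
        qed
        have "?\<rho> * norm (z q t i) \<le> ?\<rho> * M p"
          using M_bound[OF b(2), of p i] q by (intro mult_left_mono) auto
        also have "\<dots> \<le> 1 / (real p + 1)"
          using hit_high[OF s b(2) \<open>s \<noteq> t\<close> H_A[OF n], of i j] b(3,4) False True q by simp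
        finally show ?thesis using eq by simp
      next
        case times_differ: False
        have iL: "i \<in> {1..L q}" using b(3) lL[of q] by simp
        \<comment> \<open>The first three conditions concern only coordinates beyond \<open>L p\<close>, not beyond \<open>l p\<close>.\<close>
        have jL: "j > L p"
          using same_time[OF n b(1) s b(2) _ iL b(4)] times_differ j by fastforce
        define r where "r = max p q"
        have "?\<rho> \<le> \<epsilon> (L r)"
        proof (cases "s = t")
          case True
          have "?\<rho> \<le> min (\<epsilon> (L p)) (\<epsilon> (L q))"
            using cond(4)[OF L1 H_A[OF n] H_A[OF b(1)] s iL jL] b(4) True by simp
          then show ?thesis by (simp add: r_def max_def split: if_splits)
        next
          case False
          show ?thesis
          proof (cases "q < p")
            case True
            then have "L q < L p" using L_mono by (simp add: strict_mono_less)
            then show ?thesis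
              using cond(6)[OF _ H_A[OF n] H_A[OF b(1)] s b(2) False iL jL b(4)[symmetric]] True
              by (simp add: r_def)
          next
            case pq: False
            then show ?thesis
              using cond(5)[OF L1 H_A[OF n] H_A[OF b(1)] times_differ s b(2) False iL jL b(4)[symmetric]]
              by (simp add: r_def)
          qed
        qed
        moreover have "norm (z q t i) \<le> M r"
          using M_bound[OF b(2), of q i] monoD[OF M_mono, of q r] by (simp add: r_def)
        moreover have "\<epsilon> (L r) \<ge> 0" using cond(1)[OF L1, of r] by simp
        ultimately have "?\<rho> * norm (z q t i) \<le> \<epsilon> (L r) * M r" by (intro mult_mono) auto
        also have "\<dots> \<le> 1 / (real r + 1)" by (rule \<epsilon>_M[OF lL])
        also have "\<dots> \<le> 1 / (real p + 1)" by (intro divide_left_mono) (auto simp: r_def)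
        finally show ?thesis using eq by simp
      qed
    qed simp
    moreover have "norm (z p s j) \<le> 1 / (real p + 1)" using tail[OF s] False by simp
    ultimately show ?thesis
      using norm_triangle_ineq4[of "W s j n * X ((f s ^^ n) j)" "z p s j"] by simp
  qed

  show ?thesis
    unfolding disjoint_hypercyclic_def
  proof (intro bexI[OF _ x] allI impI)
    fix V :: "nat \<Rightarrow> (nat \<Rightarrow>\<^sub>C 'k) set"
    assume V: "\<forall>s\<in>{1..N}. openin (top_of_set c0) (V s) \<and> V s \<noteq> {}"
    have "\<exists>v e. e > 0 \<and> v \<in> c0 \<and> (\<forall>u\<in>c0. dist u v < e \<longrightarrow> u \<in> V s)" if s: "s \<in> {1..N}" for s
    proof -
      obtain v where v: "v \<in> V s" using V s by blast
      have "openin (top_of_set c0) (V s)" using V s by blast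
      with v show ?thesis unfolding openin_euclidean_subtopology_iff by blast
    qed
    then obtain v e where v: "\<And>s. s \<in> {1..N} \<Longrightarrow> e s > 0"
        "\<And>s. s \<in> {1..N} \<Longrightarrow> v s \<in> c0"
        "\<And>s u. \<lbrakk>s \<in> {1..N}; u \<in> c0; dist u (v s) < e s\<rbrakk> \<Longrightarrow> u \<in> V s"
      by metis
    define d where "d = Min (e ` {1..N})"
    have ne: "e ` {1..N} \<noteq> {}" using N by simp
    have d_le: "d \<le> e s" if "s \<in> {1..N}" for s unfolding d_def using that by (intro Min_le) auto
    have d: "d > 0" unfolding d_def using v(1) ne by (subst Min_gr_iff) auto
    \<comment> \<open>Half of \<open>d\<close> is reserved for the two errors: orbit to target, and target to \<open>v\<close>.\<close>
    obtain P :: nat where P: "8 / d < real P" using reals_Archimedean2 by blast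
    have "apply_bcontfun (v s) \<longlonglongrightarrow> 0" if "s \<in> {1..N}" for s using v(2)[OF that] by (simp add: c0_def)
    from z_dense[of "\<lambda>s. apply_bcontfun (v s)", OF this, of "d / 4" P]
    obtain p where p: "p \<ge> P" "\<And>s j. \<lbrakk>s \<in> {1..N}; j \<ge> 1\<rbrakk> \<Longrightarrow>
        norm (z p s j - apply_bcontfun (v s) j) \<le> d / 4" using d by auto
    have "8 / d \<le> real p + 1" using P p(1) by simp
    then have small: "2 / (real p + 1) \<le> d / 4" using d by (simp add: field_simps)
    have hit: "(T s ^^ n) x \<in> V s" if n: "n \<in> H p" and s: "s \<in> {1..N}" for n s
    proof (rule v(3)[OF s])
      show Tx: "(T s ^^ n) x \<in> c0" by (rule pseudo_shift_funpow_in_c0[OF shift[OF s] x])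
      have "dist ((T s ^^ n) x) (v s) \<le> d / 4 + d / 4"
      proof (rule dist_bound)
        fix j
        show "dist (apply_bcontfun ((T s ^^ n) x) j) (apply_bcontfun (v s) j) \<le> d / 4 + d / 4"
        proof (cases "j = 0")
          case True
          then show ?thesis using Tx v(2)[OF s] d by (simp add: c0_def)
        next
          case False
          then have j: "j \<ge> 1" by simp
          have "norm (W s j n * X ((f s ^^ n) j) - z p s j) \<le> d / 4"
            using estimate[OF n s j] small by simp
          from norm_triangle_le[OF add_mono[OF this p(2)[OF s j]]] show ?thesis
            by (simp add: dist_norm pseudo_shift_funpow_apply[OF shift[OF s] j] X_def)
        qed
      qed
      also have "\<dots> < e s" using d d_le[OF s] by simp
      finally show "dist ((T s ^^ n) x) (v s) < e s" .
    qed
    show "{n. n \<ge> 1 \<and> (\<forall>s\<in>{1..N}. (T s ^^ n) x \<in> V s)} \<in> \<A>"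
    proof (rule density_family_almost_superset[OF fam H_fam[of p]])
      have "H p - {n. n \<ge> 1 \<and> (\<forall>s\<in>{1..N}. (T s ^^ n) x \<in> V s)} = {}"
        using hit density_family_subset[OF fam H_fam[of p]] by auto
      then show "finite (H p - {n. n \<ge> 1 \<and> (\<forall>s\<in>{1..N}. (T s ^^ n) x \<in> V s)})"
        by (simp only: finite.emptyI)
    qed auto
  qed
qed

lemma disjoint_hypercyclic_iff_weight_conditions:
  assumes "N \<ge> 1" "\<A> \<in> {A_inf, A_uBd, A_ud, A_ld}" "weakly_partition_regular \<A> N f"
  shows "disjoint_hypercyclic \<A> c0 N T \<longleftrightarrow>
    (\<exists>A \<epsilon>. (\<forall>k\<ge>1. A k \<in> \<A>) \<and> weight_conditions A \<epsilon>)"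
  using weight_conditions_of_disjoint_hypercyclic[OF assms(2)]
    disjoint_hypercyclic_of_weight_conditions[OF assms] by blast


section \<open>Weight conditions in terms of inverse iterates\<close>

text \<open>
  The following equivalences replace a point of an image by its preimages; used as rewrite rules,
  they turn the conditions stated with inverse iterates into \<open>weight_conditions\<close>.
\<close>

lemma ball_image_Int_iff:
  assumes "\<And>i. i \<in> I \<Longrightarrow> g (h i) = i" "\<And>i'. i' \<in> J \<Longrightarrow> g' (h' i') = i'"
  shows "(\<forall>y\<in>h ` I \<inter> h' ` J. Q (g' y) (g y)) \<longleftrightarrow> (\<forall>i\<in>I. \<forall>i'\<in>J. h i = h' i' \<longrightarrow> Q i' i)"
proof (intro iffI ballI impI)
  fix i i' assume *: "\<forall>y\<in>h ` I \<inter> h' ` J. Q (g' y) (g y)" "i \<in> I" "i' \<in> J" "h i = h' i'"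
  then have "h i \<in> h ` I \<inter> h' ` J" by (metis IntI imageI)
  with *(1) have "Q (g' (h i)) (g (h i))" by (rule bspec)
  then show "Q i' i" using assms(1)[OF *(2)] assms(2)[OF *(3)] *(4) by simp
next
  fix y assume *: "\<forall>i\<in>I. \<forall>i'\<in>J. h i = h' i' \<longrightarrow> Q i' i" "y \<in> h ` I \<inter> h' ` J"
  then obtain i i' where i: "i \<in> I" "y = h i" and i': "i' \<in> J" "y = h' i'" by blast
  with *(1) have "Q i' i" by simp
  then show "Q (g' y) (g y)" using assms(1)[OF i(1)] assms(2)[OF i'(1)] i(2) i'(2) by simp
qed

lemma iter_inv_shift: "s \<in> {1..N} \<Longrightarrow> i \<ge> 1 \<Longrightarrow> iter_inv (f s) n ((f s ^^ n) i) = i"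
  by (rule iter_inv_funpow[OF shift])

lemma inverse_form_same_shift:
  assumes "s \<in> {1..N}"
  shows "(\<forall>j \<in> (f s ^^ m) ` {1..k} \<inter> (f s ^^ n) ` {l<..}.
      norm (W s (iter_inv (f s) n j) n) / norm (W s (iter_inv (f s) m j) m) \<le> c) \<longleftrightarrow>
    (\<forall>i\<in>{1..k}. \<forall>i'>l. (f s ^^ m) i = (f s ^^ n) i' \<longrightarrow>
      norm (W s i' n) / norm (W s i m) \<le> c)"
  using ball_image_Int_iff[of "{1..k}" "iter_inv (f s) m" "f s ^^ m" "{l<..}" "iter_inv (f s) n"
      "f s ^^ n" "\<lambda>i' i. norm (W s i' n) / norm (W s i m) \<le> c"] iter_inv_shift[OF assms]
  by (simp add: Ball_def[of "{l<..}"])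

lemma inverse_form_single:
  assumes "s \<in> {1..N}"
  shows "(y \<in> (f s ^^ n) ` {l<..} \<longrightarrow> norm (W s (iter_inv (f s) n y) n) / b \<le> c) \<longleftrightarrow>
    (\<forall>i'>l. y = (f s ^^ n) i' \<longrightarrow> norm (W s i' n) / b \<le> c)"
  using iter_inv_shift[OF assms] by auto

lemma inverse_form_same_time:
  assumes "s \<in> {1..N}" "t \<in> {1..N}"
  shows "(\<forall>j \<in> (f t ^^ n) ` {1..l} \<inter> (f s ^^ n) ` {1..l}.
        norm (W s (iter_inv (f s) n j) n / W t (iter_inv (f t) n j) n
          - a s (iter_inv (f s) n j) / a t (iter_inv (f t) n j)) \<le> \<delta>) \<and>
      (\<forall>j \<in> (f t ^^ n) ` {1..l} \<inter> (f s ^^ n) ` {l<..}.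
        norm (W s (iter_inv (f s) n j) n) / norm (W t (iter_inv (f t) n j) n) \<le> \<delta>) \<longleftrightarrow>
    (\<forall>i\<in>{1..l}.
      (\<forall>i'\<in>{1..l}. (f t ^^ n) i = (f s ^^ n) i' \<longrightarrow>
         norm (W s i' n / W t i n - a s i' / a t i) \<le> \<delta>) \<and>
      (\<forall>i'>l. (f t ^^ n) i = (f s ^^ n) i' \<longrightarrow>
         norm (W s i' n) / norm (W t i n) \<le> \<delta>))"
  using ball_image_Int_iff[of "{1..l}" "iter_inv (f t) n" "f t ^^ n" "{1..l}" "iter_inv (f s) n"
      "f s ^^ n" "\<lambda>i' i. norm (W s i' n / W t i n - a s i' / a t i) \<le> \<delta>"]
    ball_image_Int_iff[of "{1..l}" "iter_inv (f t) n" "f t ^^ n" "{l<..}" "iter_inv (f s) n"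
      "f s ^^ n" "\<lambda>i' i. norm (W s i' n) / norm (W t i n) \<le> \<delta>"]
    iter_inv_shift[OF assms(1)] iter_inv_shift[OF assms(2)]
  by (simp add: ball_conj_distrib Ball_def[of "{l<..}"])

end


section \<open>The characterization\<close>

theorem theorem2p6:
  fixes N :: nat
    and f :: "nat \<Rightarrow> nat \<Rightarrow> nat"
    and w :: "nat \<Rightarrow> nat \<Rightarrow> 'k::{real_normed_field,euclidean_space}"
    and \<A> :: "nat set set"
  defines "W \<equiv> \<lambda>s. weight_prod (f s) (w s)"
    and "g \<equiv> \<lambda>s. iter_inv (f s)"
  assumes "N \<ge> 2"
    and "\<forall>s\<in>{1..N}. is_pseudo_shift (f s) (w s)"
    and "\<A> \<in> {A_inf, A_uBd, A_ud, A_ld}"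
    and "weakly_partition_regular \<A> N f"
  shows "disjoint_hypercyclic \<A> c0 N (\<lambda>s. pseudo_shift (f s) (w s)) \<longleftrightarrow>
    (\<exists>(A :: nat \<Rightarrow> nat set) (\<epsilon> :: nat \<Rightarrow> real).
      (\<forall>k\<ge>1. A k \<in> \<A>) \<and> (\<forall>k\<ge>1. \<epsilon> k > 0) \<and> \<epsilon> \<longlonglongrightarrow> 0 \<and>
      \<comment> \<open>(1)\<close>
      (\<forall>k\<ge>1. \<forall>j\<in>{1..k}. \<forall>s\<in>{1..N}.
         filterlim (\<lambda>n. norm (W s j n)) at_top (inf sequentially (principal (A k)))) \<and>
      (\<forall>l\<ge>1. \<forall>k\<ge>1. \<forall>n\<in>A l. \<forall>m\<in>A k. \<forall>s\<in>{1..N}.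
         \<forall>j \<in> (f s ^^ m) ` {1..k} \<inter> (f s ^^ n) ` {l<..}.
           norm (W s (g s n j) n) / norm (W s (g s m j) m) \<le> min (\<epsilon> l) (\<epsilon> k)) \<and>
      \<comment> \<open>(2)\<close>
      (\<forall>l\<ge>1. \<forall>j\<in>{1..l}. \<forall>k\<ge>1. \<forall>n\<in>A k. \<forall>s\<in>{1..N}. \<forall>t\<in>{1..N}. s \<noteq> t \<longrightarrow>
         (\<forall>m\<in>A l - {n}. (f t ^^ m) j \<in> (f s ^^ n) ` {k<..} \<longrightarrow>
           norm (W s (g s n ((f t ^^ m) j)) n) / norm (W t j m) \<le> \<epsilon> l)) \<and>
      \<comment> \<open>(3)\<close>
      (\<forall>k\<ge>1. \<forall>l>k. \<forall>j\<in>{1..k}. \<forall>n\<in>A l. \<forall>s\<in>{1..N}. \<forall>t\<in>{1..N}. s \<noteq> t \<longrightarrow>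
         (\<forall>m\<in>A k. (f t ^^ m) j \<in> (f s ^^ n) ` {l<..} \<longrightarrow>
           norm (W s (g s n ((f t ^^ m) j)) n) / norm (W t j m) \<le> \<epsilon> l)) \<and>
      \<comment> \<open>(4)\<close>
      (\<forall>l\<ge>1. \<forall>a :: nat \<Rightarrow> nat \<Rightarrow> 'k. \<forall>\<delta>>0.
         (\<forall>s\<in>{1..N}. \<forall>j\<in>{1..l}. a s j \<noteq> 0) \<longrightarrow>
         (\<exists>L\<ge>l. \<forall>s\<in>{1..N}. \<forall>t\<in>{1..N}. s \<noteq> t \<longrightarrow> (\<forall>n\<in>A L.
           (\<forall>j \<in> (f t ^^ n) ` {1..l} \<inter> (f s ^^ n) ` {1..l}.
              norm (W s (g s n j) n / W t (g t n j) n - a s (g s n j) / a t (g t n j)) \<le> \<delta>) \<and>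
           (\<forall>j \<in> (f t ^^ n) ` {1..l} \<inter> (f s ^^ n) ` {l<..}.
              norm (W s (g s n j) n) / norm (W t (g t n j) n) \<le> \<delta>)))))"
proof -
  interpret pseudo_shift_tuple N f w by unfold_locales (use assms(4) in blast)
  have "1 \<le> N" using assms(3) by simp
  note main = disjoint_hypercyclic_iff_weight_conditions[OF this assms(5,6)]
  show ?thesis
    unfolding main weight_conditions_def W_def g_def
    by (simp only: inverse_form_same_shift inverse_form_single inverse_form_same_time
        cong: ball_cong)
qed

end
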